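(* Let $L\in NBV([0,1];\mathbb R)$ be continuous at $0$, extended by $L(a)=0$ for $a\le0$ and $L(a)=L(1)$ for $a\ge1$, and let $R$ be the resolvent of $L$. Let $Y=NBV([-1,0];\mathbb R)$ (normalized to be zero at $0$) and $Y^\diamond=B([0,1];\mathbb R)$ with pairing $\langle y^\diamond,y\rangle=\int_{-1}^0y^\diamond(-\theta)\,y(d\theta)$. Let $\{S_0(t)\}$ be the twin semigroup $(S_0(t)\psi)(\theta)=\psi(t+\theta)$ if $t+\theta\le0$ and $=0$ if $t+\theta>0$, with generator $C_0$ given by $\mathcal D(C_0)=\{\psi:\exists\varphi\in Y,\ \psi(\theta)=\int_0^\theta\varphi(\sigma)\,d\sigma\}$, $C_0\psi=\{\varphi\in Y:\psi(\theta)=\int_0^\theta\varphi(\sigma)\,d\sigma\}$. Let $q\in Y$ be given by $q(0)=0$, $q(\theta)=-1$ for $-1\le\theta<0$, and let $Q^\diamond\in Y^\diamond$ be given by $Q^\diamond(\theta)=L(\theta)-L(1)$, $0\le\theta\le1$. Put $V_0(t)\psi=Q^\diamond(S_0(t)-I)\psi$ and $K(t)=V_0(t)q$, let $R_K$ be the resolvent of $K$, and put $V(t)\psi=V_0(t)\psi+\int_0^tR_K(d\tau)V_0(t-\tau)\psi$. Put $y^\diamond W_0(t)=y^\diamond S_0(t)q$ for $t>0$ and $W_0(0)=0$. Let $\{S(t)\}_{t\ge0}$ be the twin semigroup on $(Y,Y^\diamond)$ defined by $$S(t)=S_0(t)+\int_0^tW_0(t-\tau)\cdot V(d\tau),\quad\text{i.e.}\quad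 y^\diamond S(t)\psi=y^\diamond S_0(t)\psi+\int_0^ty^\diamond W_0(t-\tau)\,V(d\tau)\psi .$$ For $\psi\in Y$ define $B(\theta)=\psi(\theta)$ for $-1\le\theta\le0$ and, for $t>0$, $$B(t)=f(t)+\int_{[0,t]}R(da)f(t-a),\qquad f(t)=\int_{(t,1]}L(da)\,\psi(t-a)-\int_{[0,1]}L(da)\,\psi(-a).$$ Then $$(S(t)\psi)(\theta)=B(t+\theta)-B(t).$$
   Context: $B([0,1];\mathbb R)$: bounded Borel functions with supremum norm. $NBV([0,1])$: functions of bounded variation on $[0,1]$, zero at $0$ and right-continuous on $(0,1)$; $L(da)$ is the measure on $[0,1]$ that assigns the value $L(t)$ to $[0,t]$, $0<t\le1$. $NBV([-1,0])$ (for $Y$): functions $\psi$ of bounded variation on $[-1,0]$ with $\psi(0)=0$ and right-continuous on $(-1,0)$, with total variation norm; $\psi(d\theta)$ is the corresponding measure on $[-1,0]$. $y^\diamond S_0(t)\psi$ means $\langle y^\diamond,S_0(t)\psi\rangle$. The interval $(t,1]$ is empty for $t\ge1$. $NBV_{loc}([0,\infty))$ consists of the functions $F$ on $[0,\infty)$ of locally bounded variation, with $F(0)=0$, right-continuous on $(0,\infty)$; $F(d\tau)$ is the Radon measure on $[0,\infty)$ that assigns the value $F(t)$ to $[0,t]$ for $t>0$. Integrals $\int_0^t$ against such measures are over $[0,t]$. The resolvent of a function $K\in NBV_{loc}$ (continuous at $0$) is the unique $R\in NBV_{loc}$ with $R(a)=\int_{[0,a]}K(a-\sigma)R(d\sigma)+K(a)$.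 The function $B$ solves the time-integrated renewal equation $B(t)=\int_{[0,t]}L(da)B(t-a)+f(t)$, $t>0$, i.e. the cumulative version of $b(t)=\int_0^1L(da)b(t-a)$. A twin operator on $(Y,Y^\diamond)$ is a bounded bilinear map $(y^\diamond,y)\mapsto y^\diamond Ty$ on $Y^\diamond\times Y$ that is represented both by a map $Y\to Y$ ($\langle y^\diamond,Ty\rangle=y^\diamond Ty$) and by a map $Y^\diamond\to Y^\diamond$ ($\langle y^\diamond T,y\rangle=y^\diamond Ty$). A twin semigroup is a family $\{S(t)\}_{t\ge0}$ of twin operators with $S(0)=I$, $S(t+s)=S(t)S(s)$, $|y^\diamond S(t)y|\le Me^{\omega t}\|y\|\|y^\diamond\|$, $t\mapsto y^\diamond S(t)y$ measurable, and such that for $\operatorname{Re}\lambda>\omega$ the bilinear map $\int_0^\infty e^{-\lambda t}y^\diamond S(t)y\,dt$ is a twin operator $\overline S(\lambda)$; its generator is the (possibly multi-valued) operator $C$ on $Y$ with $(\lambda I-C)^{-1}=\overline S(\lambda)$.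
   Formalization: That S(t), given by the formula, is a twin semigroup is taken as a hypothesis; with W_0(0)=0 and integrals over [0,t] it holds only if L has no jumps. For L with jumps (e.g. L=1 for a≥1, else 0; ψ=q, t=1) the formula gives no semigroup and the identity fails. *)

theory Defs
  imports "HOL-Analysis.Analysis"
begin

section \<open>Functions of bounded variation and Stieltjes integrals\<close>

definition variation :: "(real \<Rightarrow> real) \<Rightarrow> real set \<Rightarrow> ennreal" where
  "variation F A =
     (SUP (n, x) \<in> {(n::nat, x::nat \<Rightarrow> real). (\<forall>i\<le>n. x i \<in> A) \<and> (\<forall>i<n. x i \<le> x (Suc i))}.
        \<Sum>i<n. ennreal \<bar>F (x (Suc i)) - F (x i)\<bar>)"

definition bounded_variation_on :: "(real \<Rightarrow> real) \<Rightarrow> real set \<Rightarrow> bool" where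
  "bounded_variation_on F A \<longleftrightarrow> variation F A < \<infinity>"

text \<open>
  A function on \<open>[a, b]\<close> is represented by its constant extension to the real line, and a
  function on \<open>[0, \<infinity>)\<close> that vanishes at \<open>0\<close> by its extension by zero. So equality of these
  total functions is equality on the original interval.
\<close>

definition NBV :: "real \<Rightarrow> real \<Rightarrow> (real \<Rightarrow> real) set" where
  "NBV a b = {F. F 0 = 0 \<and>
     bounded_variation_on F {a..b} \<and>
     (\<forall>x\<in>{a<..<b}. continuous (at_right x) F) \<and>
     (\<forall>x\<le>a. F x = F a) \<and> (\<forall>x\<ge>b. F x = F b)}"

definition NBV_loc :: "(real \<Rightarrow> real) set" where
  "NBV_loc = {F. (\<forall>x\<le>0. F x = 0) \<and>
     (\<forall>T\<ge>0. bounded_variation_on F {0..T}) \<and>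
     (\<forall>x>0. continuous (at_right x) F)}"

text \<open>
  The signed measure of \<open>F\<close> has distribution function \<open>t \<mapsto> F(t+)\<close>. It thus has an atom of
  mass \<open>F(c+) - F(c)\<close> at a left endpoint \<open>c\<close> where \<open>F\<close> is not right-continuous. For \<open>F\<close> in
  \<open>NBV 0 1\<close> or in \<open>NBV_loc\<close>, the interval \<open>[0, t]\<close> gets the value \<open>F t\<close> for \<open>t > 0\<close>. For
  \<open>F\<close> in \<open>NBV (-1) 0\<close>, the interval \<open>(\<theta>, 0]\<close> gets \<open>- F \<theta>\<close> for \<open>-1 < \<theta> < 0\<close>, and \<open>[-1, 0]\<close>
  gets \<open>- F (-1)\<close>. The integral is the difference of the integrals against the measures of
  the two increasing functions \<open>v\<close> and \<open>v - F(\<cdot>+)\<close>, where \<open>v\<close> is the variation function of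
  \<open>F(\<cdot>+)\<close>.
\<close>

definition right_lim :: "(real \<Rightarrow> real) \<Rightarrow> real \<Rightarrow> real" where
  "right_lim F t = Lim (at_right t) F"

definition variation_fun :: "(real \<Rightarrow> real) \<Rightarrow> real \<Rightarrow> real" where
  "variation_fun F t = enn2real (variation (right_lim F) {..t})"

definition stieltjes :: "(real \<Rightarrow> real) \<Rightarrow> real set \<Rightarrow> (real \<Rightarrow> real) \<Rightarrow> real" where
  "stieltjes F A g =
     (LINT x:A|interval_measure (variation_fun F). g x) -
     (LINT x:A|interval_measure (\<lambda>t. variation_fun F t - right_lim F t). g x)"

definition is_resolvent :: "(real \<Rightarrow> real) \<Rightarrow> (real \<Rightarrow> real) \<Rightarrow> bool" where
  "is_resolvent K R \<longleftrightarrow>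
     R \<in> NBV_loc \<and> (\<forall>a\<ge>0. R a = stieltjes R {0..a} (\<lambda>\<sigma>. K (a - \<sigma>)) + K a)"


section \<open>The dual pair, twin operators and twin semigroups\<close>

definition Y :: "(real \<Rightarrow> real) set" where
  "Y = NBV (-1) 0"

definition normY :: "(real \<Rightarrow> real) \<Rightarrow> real" where
  "normY \<psi> = enn2real (variation \<psi> {-1..0})"

text \<open>Functions on \<open>[0, 1]\<close> are here extended by zero.\<close>

definition Yd :: "(real \<Rightarrow> real) set" where
  "Yd = {g. g \<in> borel_measurable borel \<and> bounded (range g) \<and> (\<forall>a. a \<notin> {0..1} \<longrightarrow> g a = 0)}"

definition normYd :: "(real \<Rightarrow> real) \<Rightarrow> real" where
  "normYd g = (SUP a\<in>{0..1}. \<bar>g a\<bar>)"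

definition pairing :: "(real \<Rightarrow> real) \<Rightarrow> (real \<Rightarrow> real) \<Rightarrow> real" where
  "pairing yd y = stieltjes y {-1..0} (\<lambda>\<theta>. yd (- \<theta>))"

type_synonym bilin = "(real \<Rightarrow> real) \<Rightarrow> (real \<Rightarrow> real) \<Rightarrow> real"

definition bounded_bilinear_on_pair :: "bilin \<Rightarrow> bool" where
  "bounded_bilinear_on_pair T \<longleftrightarrow>
     (\<forall>yd\<in>Yd. \<forall>y\<in>Y. \<forall>z\<in>Y. \<forall>c d. T yd (\<lambda>\<theta>. c * y \<theta> + d * z \<theta>) = c * T yd y + d * T yd z) \<and>
     (\<forall>yd\<in>Yd. \<forall>zd\<in>Yd. \<forall>y\<in>Y. \<forall>c d. T (\<lambda>a. c * yd a + d * zd a) y = c * T yd y + d * T zd y) \<and>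
     (\<exists>C. \<forall>yd\<in>Yd. \<forall>y\<in>Y. \<bar>T yd y\<bar> \<le> C * normYd yd * normY y)"

definition twin_operator :: "bilin \<Rightarrow> bool" where
  "twin_operator T \<longleftrightarrow>
     bounded_bilinear_on_pair T \<and>
     (\<exists>F\<in>Y \<rightarrow> Y. \<forall>yd\<in>Yd. \<forall>y\<in>Y. pairing yd (F y) = T yd y) \<and>
     (\<exists>G\<in>Yd \<rightarrow> Yd. \<forall>yd\<in>Yd. \<forall>y\<in>Y. pairing (G yd) y = T yd y)"

text \<open>
  The representing map of a twin operator on \<open>Y\<close>, written \<open>y \<mapsto> T y\<close> in the mathematics. The
  description is unique since \<open>Yd\<close> separates the points of \<open>Y\<close>.
\<close>

definition act :: "bilin \<Rightarrow> (real \<Rightarrow> real) \<Rightarrow> (real \<Rightarrow> real)" where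
  "act T y = (THE z. z \<in> Y \<and> (\<forall>yd\<in>Yd. pairing yd z = T yd y))"

definition laplace :: "(real \<Rightarrow> bilin) \<Rightarrow> complex \<Rightarrow> (real \<Rightarrow> real) \<Rightarrow> (real \<Rightarrow> real) \<Rightarrow> complex" where
  "laplace S z yd y = (LINT t:{0..}|lborel. exp (- z * of_real t) * of_real (S t yd y))"

text \<open>
  On the real spaces \<open>Y\<close> and \<open>Yd\<close>, the Laplace transform at a complex \<open>z\<close> is a twin operator
  on the complexified pair if and only if its real and imaginary parts are twin operators.
\<close>

definition twin_semigroup_type :: "(real \<Rightarrow> bilin) \<Rightarrow> real \<Rightarrow> real \<Rightarrow> bool" where
  "twin_semigroup_type S M \<omega> \<longleftrightarrow>
     (\<forall>t\<ge>0. twin_operator (S t)) \<and>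
     (\<forall>yd\<in>Yd. \<forall>y\<in>Y. S 0 yd y = pairing yd y) \<and>
     (\<forall>t\<ge>0. \<forall>s\<ge>0. \<forall>yd\<in>Yd. \<forall>y\<in>Y. S (t + s) yd y = S t yd (act (S s) y)) \<and>
     (\<forall>t\<ge>0. \<forall>yd\<in>Yd. \<forall>y\<in>Y. \<bar>S t yd y\<bar> \<le> M * exp (\<omega> * t) * normY y * normYd yd) \<and>
     (\<forall>yd\<in>Yd. \<forall>y\<in>Y. (\<lambda>t. S t yd y) \<in> borel_measurable (restrict_space borel {0..})) \<and>
     (\<forall>z. Re z > \<omega> \<longrightarrow>
        twin_operator (\<lambda>yd y. Re (laplace S z yd y)) \<and>
        twin_operator (\<lambda>yd y. Im (laplace S z yd y)))"

definition twin_semigroup :: "(real \<Rightarrow> bilin) \<Rightarrow> bool" where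
  "twin_semigroup S \<longleftrightarrow> (\<exists>M \<omega>. twin_semigroup_type S M \<omega>)"

text \<open>
  A multi-valued operator on \<open>Y\<close> is given by its graph \<open>C\<close>. The left-hand side below is the
  graph of the inverse of \<open>\<lambda> I - C\<close>. Real \<open>\<lambda>\<close> suffice to determine \<open>C\<close>.
\<close>

definition is_generator :: "(real \<Rightarrow> bilin) \<Rightarrow> ((real \<Rightarrow> real) \<times> (real \<Rightarrow> real)) set \<Rightarrow> bool" where
  "is_generator S C \<longleftrightarrow>
     C \<subseteq> Y \<times> Y \<and>
     (\<exists>M \<omega>. twin_semigroup_type S M \<omega> \<and>
        (\<forall>l::real. l > \<omega> \<longrightarrow>
           {(\<lambda>\<theta>. l * \<psi> \<theta> - \<phi> \<theta>, \<psi>) |\<psi> \<phi>. (\<psi>, \<phi>) \<in> C} =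
           {(\<psi>, act (\<lambda>yd y. Re (laplace S (of_real l) yd y)) \<psi>) |\<psi>. \<psi> \<in> Y}))"


section \<open>The renewal equation\<close>

text \<open>Here \<open>\<theta> \<le> 0\<close>, so the oriented integral of \<open>\<phi>\<close> from \<open>0\<close> to \<open>\<theta>\<close> carries a minus sign.\<close>

definition C0 :: "((real \<Rightarrow> real) \<times> (real \<Rightarrow> real)) set" where
  "C0 = {(\<psi>, \<phi>). \<psi> \<in> Y \<and> \<phi> \<in> Y \<and> (\<forall>\<theta>\<in>{-1..0}. \<psi> \<theta> = - (LINT \<sigma>:{\<theta>..0}|lborel. \<phi> \<sigma>))}"

definition q :: "real \<Rightarrow> real" where
  "q \<theta> = (if \<theta> < 0 then -1 else 0)"

definition Qd :: "(real \<Rightarrow> real) \<Rightarrow> real \<Rightarrow> real" where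
  "Qd L a = (if 0 \<le> a \<and> a \<le> 1 then L a - L 1 else 0)"

text \<open>\<open>V0\<close>, \<open>K\<close> and \<open>V\<close> are functions of \<open>t \<ge> 0\<close>, extended by zero to negative \<open>t\<close>.\<close>

definition V0 :: "(real \<Rightarrow> real) \<Rightarrow> (real \<Rightarrow> bilin) \<Rightarrow> real \<Rightarrow> (real \<Rightarrow> real) \<Rightarrow> real" where
  "V0 L S0 t \<psi> = (if t < 0 then 0 else S0 t (Qd L) \<psi> - pairing (Qd L) \<psi>)"

definition K :: "(real \<Rightarrow> real) \<Rightarrow> (real \<Rightarrow> bilin) \<Rightarrow> real \<Rightarrow> real" where
  "K L S0 t = V0 L S0 t q"

definition V :: "(real \<Rightarrow> real) \<Rightarrow> (real \<Rightarrow> bilin) \<Rightarrow> (real \<Rightarrow> real) \<Rightarrow> real \<Rightarrow> (real \<Rightarrow> real) \<Rightarrow> real" where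
  "V L S0 RK t \<psi> =
     (if t < 0 then 0
      else V0 L S0 t \<psi> + stieltjes RK {0..t} (\<lambda>\<tau>. V0 L S0 (t - \<tau>) \<psi>))"

definition W0 :: "(real \<Rightarrow> bilin) \<Rightarrow> real \<Rightarrow> (real \<Rightarrow> real) \<Rightarrow> real" where
  "W0 S0 t yd = (if t > 0 then S0 t yd q else 0)"

definition forcing :: "(real \<Rightarrow> real) \<Rightarrow> (real \<Rightarrow> real) \<Rightarrow> real \<Rightarrow> real" where
  "forcing L \<psi> t =
     stieltjes L {t<..1} (\<lambda>a. \<psi> (t - a)) - stieltjes L {0..1} (\<lambda>a. \<psi> (- a))"

definition B :: "(real \<Rightarrow> real) \<Rightarrow> (real \<Rightarrow> real) \<Rightarrow> (real \<Rightarrow> real) \<Rightarrow> real \<Rightarrow> real" where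
  "B L R \<psi> t =
     (if t \<le> 0 then \<psi> t
      else forcing L \<psi> t + stieltjes R {0..t} (\<lambda>a. forcing L \<psi> (t - a)))"

end

theory Submission
  imports Defs
begin

text \<open>
  Write \<open>V(t)\<close> for \<open>V(t)\<psi>\<close> and test \<open>S(t)\<psi>\<close> against indicators of intervals, which evaluate an element of
  \<open>Y\<close> at a point. Since \<open>W\<^sub>0(t - \<tau>)\<close> paired with such an indicator is the indicator of
  \<open>t + \<theta> < \<tau> < t\<close>, the definition of \<open>S\<close> becomes, for \<open>-1 \<le> \<theta> < 0 < t\<close>,

    \<open>(S(t)\<psi>)(\<theta>) = \<psi>(t + \<theta>) + V(max(0, t + \<theta>)) - V(t-)\<close>.

  So two things have to be shown: \<open>V(t) = B(t)\<close> for \<open>t > 0\<close>, and \<open>V(t-) = V(t)\<close>.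

  Neither holds for an arbitrary \<open>L\<close>: the left limit appears because \<open>W\<^sub>0(0) = 0\<close>, and an atom of
  \<open>L\<close> at \<open>1\<close> makes \<open>V\<^sub>0\<close> differ from the forcing function, because \<open>V\<^sub>0\<close> sees \<open>\<psi>(-1+)\<close> where the
  forcing function sees \<open>\<psi>(-1)\<close>. What rescues both is that \<open>S\<close> is a semigroup. For
  \<open>\<phi> = S(s)\<psi>\<close> the displayed formula shows that the jump of \<open>S(t + s)\<psi>\<close> at \<open>\<theta> = -t\<close> is the jump of
  \<open>V\<close> at \<open>s\<close>, while the jump of \<open>S(t)\<phi>\<close> there is zero: to the right of \<open>-t\<close> starts \<open>V(\<cdot>)\<phi>\<close>, which is
  right-continuous with value \<open>0\<close> at \<open>0\<close>, and to the left \<open>\<phi>\<close> ends with the limit \<open>V(s-) - V(s-) = 0\<close>.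
  Hence \<open>V\<close> has no jumps (lemma \<open>V_no_atoms\<close>).

  For \<open>\<psi> = q\<close> one has \<open>V\<^sub>0(t)q = K(t) = L(t)\<close>, so \<open>R\<^sub>K\<close> is a resolvent of \<open>L\<close>, equal to \<open>R\<close> by uniqueness
  (\<open>resolvent_unique\<close>), and \<open>V(t)q = R(t)\<close>. So \<open>R\<close> has no jumps, and \<open>L = R - R * dL\<close> shows that \<open>L\<close> has no
  jump at \<open>1\<close> (\<open>L_no_atom_if_resolvent_atomless\<close>). Then integration by parts gives
  \<open>V\<^sub>0(t)\<psi> = f(t)\<close> (\<open>pairing_Qd\<close>, \<open>V0_eq_increment\<close>, \<open>forcing_eq_increment\<close>), and \<open>V = B\<close> on
  \<open>t > 0\<close> is the definition of both sides.

  The analysis underneath is that of Stieltjes integrals against the two increasing functions \<open>v\<close> and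
  \<open>v - F(\<cdot>+)\<close>. Two facts carry it: \<open>v\<close> is right-continuous (\<open>variation_fun_right_cont\<close>), so that these
  integrals are integrals against genuine measures with known distribution functions, and convolution
  is commutative by Fubini (\<open>conv_commute\<close>), which contains every integration by parts that is needed.
\<close>

section \<open>Functions of locally bounded variation\<close>

lemma variation_upper_bound:
  assumes w: "\<And>x y. x \<in> A \<Longrightarrow> y \<in> A \<Longrightarrow> x \<le> y \<Longrightarrow> \<bar>F y - F x\<bar> \<le> w y - w x"
    and bounds: "\<And>x. x \<in> A \<Longrightarrow> m \<le> w x \<and> w x \<le> M"
  shows "variation F A \<le> ennreal (M - m)"
  unfolding variation_def
proof (rule SUP_least, clarify)
  fix n and x :: "nat \<Rightarrow> real"
  assume x: "\<forall>i\<le>n. x i \<in> A" "\<forall>i<n. x i \<le> x (Suc i)"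
  have "(\<Sum>i<n. ennreal \<bar>F (x (Suc i)) - F (x i)\<bar>) = ennreal (\<Sum>i<n. \<bar>F (x (Suc i)) - F (x i)\<bar>)"
    by (simp add: sum_ennreal)
  also have "\<dots> \<le> ennreal (\<Sum>i<n. w (x (Suc i)) - w (x i))"
    using x by (intro ennreal_leI sum_mono w) auto
  also have "(\<Sum>i<n. w (x (Suc i)) - w (x i)) = w (x n) - w (x 0)"
    by (rule sum_lessThan_telescope)
  also have "ennreal \<dots> \<le> ennreal (M - m)"
    using bounds[of "x n"] bounds[of "x 0"] x by (intro ennreal_leI) auto
  finally show "(\<Sum>i<n. ennreal \<bar>F (x (Suc i)) - F (x i)\<bar>) \<le> ennreal (M - m)" .
qed

text \<open>
  Appending the step from \<open>s\<close> to \<open>t\<close> to a partition in \<open>A\<close> gives a partition in \<open>A'\<close>.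
\<close>

lemma variation_extend:
  assumes A: "\<And>x. x \<in> A \<Longrightarrow> x \<le> s" "A \<subseteq> A'" "s \<in> A'" "t \<in> A'" "s \<le> t" "A \<noteq> {}"
  shows "variation F A + ennreal \<bar>F t - F s\<bar> \<le> variation F A'"
proof -
  let ?P = "\<lambda>A. {(n::nat, x::nat \<Rightarrow> real). (\<forall>i\<le>n. x i \<in> A) \<and> (\<forall>i<n. x i \<le> x (Suc i))}"
  let ?S = "\<lambda>(n, x). \<Sum>i<n. ennreal \<bar>F (x (Suc i)) - F (x i)\<bar>"
  obtain a where a: "a \<in> A" using \<open>A \<noteq> {}\<close> by blast
  have "(0, \<lambda>_. a) \<in> ?P A" using a by simp
  then have ne: "?P A \<noteq> {}" by (rule ex_in_conv[THEN iffD1, OF exI])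
  have "variation F A + ennreal \<bar>F t - F s\<bar> = (SUP p\<in>?P A. ?S p + ennreal \<bar>F t - F s\<bar>)"
    unfolding variation_def using ennreal_SUP_add_left[OF ne, of ?S "ennreal \<bar>F t - F s\<bar>"] by simp
  also have "\<dots> \<le> variation F A'"
  proof (rule SUP_least, clarify)
    fix n and x :: "nat \<Rightarrow> real"
    assume x: "\<forall>i\<le>n. x i \<in> A" "\<forall>i<n. x i \<le> x (Suc i)"
    define y where "y i = (if i \<le> n then x i else if i = Suc n then s else t)" for i
    have "y i \<le> y (Suc i)" if "i < Suc (Suc n)" for i
      using x A that by (cases "i < n"; cases "i = n") (auto simp: y_def)
    moreover have "y i \<in> A'" for i
      using x A by (auto simp: y_def)
    ultimately have y: "(Suc (Suc n), y) \<in> ?P A'" by auto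
    have "(\<Sum>i<n. ennreal \<bar>F (x (Suc i)) - F (x i)\<bar>) + ennreal \<bar>F t - F s\<bar> \<le>
      (\<Sum>i<n. ennreal \<bar>F (y (Suc i)) - F (y i)\<bar>) + ennreal \<bar>F (y (Suc n)) - F (y n)\<bar> + ennreal \<bar>F t - F s\<bar>"
      by (simp add: y_def)
    also have "\<dots> = ?S (Suc (Suc n), y)" by (simp add: y_def)
    also have "\<dots> \<le> variation F A'" unfolding variation_def by (rule SUP_upper[OF y])
    finally show "(\<Sum>i<n. ennreal \<bar>F (x (Suc i)) - F (x i)\<bar>) + ennreal \<bar>F t - F s\<bar> \<le> variation F A'" .
  qed
  finally show ?thesis .
qed

text \<open>
  Local bounded variation is expressed by a single increasing majorant \<open>w\<close> of the increments,
  instead of by finite variations: sums, right limits and convolutions then inherit the property by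
  performing the same operation on majorants. Constancy near \<open>-\<infinity>\<close> is part of the notion, so that the
  measures of \<open>F\<close> live on a half-line.
\<close>

definition loc_bv :: "(real \<Rightarrow> real) \<Rightarrow> bool" where
  "loc_bv F \<longleftrightarrow> (\<exists>w c. (\<forall>x\<le>c. w x = 0) \<and> (\<forall>x y. x \<le> y \<longrightarrow> \<bar>F y - F x\<bar> \<le> w y - w x))"

lemma loc_bvI:
  assumes "\<And>x. x \<le> c \<Longrightarrow> w x = k" "\<And>x y. x \<le> y \<Longrightarrow> \<bar>F y - F x\<bar> \<le> w y - w x"
  shows "loc_bv F"
  unfolding loc_bv_def using assms
  by (intro exI[of _ "\<lambda>x. w x - k"] exI[of _ c]) simp

lemma loc_bvE:
  assumes "loc_bv F"
  obtains w c k where "\<And>x. x \<le> c \<Longrightarrow> w x = 0" "\<And>x y. x \<le> y \<Longrightarrow> \<bar>F y - F x\<bar> \<le> w y - w x"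
    "mono w" "mono (\<lambda>x. w x - F x)" "\<And>x. x \<le> c \<Longrightarrow> F x = k"
proof -
  obtain w c where w: "\<And>x. x \<le> c \<Longrightarrow> w x = 0" "\<And>x y. x \<le> y \<Longrightarrow> \<bar>F y - F x\<bar> \<le> w y - w x"
    using assms unfolding loc_bv_def by blast
  have m: "w x \<le> w y" "w x - F x \<le> w y - F y" if "x \<le> y" for x y
    using w(2)[OF that] by linarith+
  have k: "F x = F c" if "x \<le> c" for x
    using w(2)[OF that] w(1)[OF that] w(1)[of c] by linarith
  show ?thesis
    by (rule that[of c w "F c"]) (fact w k | rule monoI, fact m)+
qed

lemma loc_bv_diff:
  assumes "loc_bv F" "loc_bv G"
  shows "loc_bv (\<lambda>x. F x - G x)"
proof -
  obtain v c where v: "\<And>x. x \<le> c \<Longrightarrow> v x = 0" "\<And>x y. x \<le> y \<Longrightarrow> \<bar>F y - F x\<bar> \<le> v y - v x"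
    using assms(1) by (rule loc_bvE) blast
  obtain w d where w: "\<And>x. x \<le> d \<Longrightarrow> w x = 0" "\<And>x y. x \<le> y \<Longrightarrow> \<bar>G y - G x\<bar> \<le> w y - w x"
    using assms(2) by (rule loc_bvE) blast
  show ?thesis
  proof (rule loc_bvI[of "min c d" "\<lambda>x. v x + w x" 0])
    fix x assume "x \<le> min c d"
    then show "v x + w x = 0"
      using v(1)[of x] w(1)[of x] by simp
  next
    fix x y :: real assume "x \<le> y"
    with v(2)[of x y] w(2)[of x y]
    show "\<bar>F y - G y - (F x - G x)\<bar> \<le> v y + w y - (v x + w x)" by linarith
  qed
qed

lemma loc_bv_mono:
  assumes "mono F" "\<And>x. x \<le> c \<Longrightarrow> F x = k"
  shows "loc_bv F"
  using assms by (intro loc_bvI[of c F k]) (auto simp: mono_def)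

lemma loc_bv_const: "loc_bv (\<lambda>x. k)"
  by (rule loc_bv_mono) (auto simp: mono_def)

lemma loc_bv_add:
  assumes "loc_bv F" "loc_bv G"
  shows "loc_bv (\<lambda>x. F x + G x)"
  using loc_bv_diff[OF assms(1) loc_bv_diff[OF loc_bv_const[of 0] assms(2)]] by simp

lemma loc_bv_max:
  assumes "loc_bv F"
  shows "loc_bv (\<lambda>x. F (max 0 x))"
proof -
  obtain v c where v: "\<And>x y. x \<le> y \<Longrightarrow> \<bar>F y - F x\<bar> \<le> v y - v x"
    using assms by (rule loc_bvE) blast
  show ?thesis
    by (rule loc_bvI[of 0 "\<lambda>x. v (max 0 x)" "v 0"]) (auto intro!: v)
qed

lemma loc_bv_if_bounded_variation_on:
  assumes const: "\<And>x. x \<le> c \<Longrightarrow> F x = k"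
    and fin: "\<And>T. T \<ge> c \<Longrightarrow> bounded_variation_on F {c..T}"
  shows "loc_bv F"
proof (rule loc_bvI)
  let ?w = "\<lambda>x. enn2real (variation F {c..max c x})"
  show "?w x = ?w c" if "x \<le> c" for x using that by (simp add: max_def)
  have fin': "variation F {c..max c x} < \<infinity>" for x
    using fin[of "max c x"] by (simp add: bounded_variation_on_def)
  fix x y :: real assume xy: "x \<le> y"
  have eq: "F (max c z) = F z" for z using const[of z] const[of c] by (simp add: max_def)
  have "variation F {c..max c x} + ennreal \<bar>F (max c y) - F (max c x)\<bar> \<le> variation F {c..max c y}"
    using xy by (intro variation_extend) auto
  then have "enn2real (variation F {c..max c x} + ennreal \<bar>F (max c y) - F (max c x)\<bar>) \<le> ?w y"
    using fin'[of y] by (intro enn2real_mono) auto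
  also have "enn2real (variation F {c..max c x} + ennreal \<bar>F (max c y) - F (max c x)\<bar>)
     = ?w x + \<bar>F (max c y) - F (max c x)\<bar>"
    using fin'[of x] by (subst enn2real_plus) auto
  finally show "\<bar>F y - F x\<bar> \<le> ?w y - ?w x" by (simp add: eq)
qed

text \<open>
  Beyond \<open>b\<close> the function is constant, so cutting a partition of \<open>[a, T]\<close> at \<open>b\<close> does not change its sum.
\<close>

lemma NBV_loc_bv:
  assumes F: "F \<in> NBV a b" and "a \<le> b"
  shows "loc_bv F"
proof (rule loc_bv_if_bounded_variation_on)
  have c: "(\<forall>x\<le>a. F x = F a) \<and> (\<forall>x\<ge>b. F x = F b)"
    by (rule F[unfolded NBV_def mem_Collect_eq, THEN conjunct2, THEN conjunct2, THEN conjunct2])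
  have const: "F x = F a" if "x \<le> a" for x using c that by blast
  have const': "F x = F b" if "b \<le> x" for x using c that by blast
  have bv: "bounded_variation_on F {a..b}"
    using F unfolding NBV_def mem_Collect_eq by (elim conjE)
  show "F x = F a" if "x \<le> a" for x using that by (rule const)
  fix T
  assume "a \<le> T"
  let ?P = "\<lambda>A. {(n::nat, x::nat \<Rightarrow> real). (\<forall>i\<le>n. x i \<in> A) \<and> (\<forall>i<n. x i \<le> x (Suc i))}"
  let ?S = "\<lambda>(n, x). \<Sum>i<n. ennreal \<bar>F (x (Suc i)) - F (x i)\<bar>"
  have "variation F {a..T} \<le> variation F {a..b}"
    unfolding variation_def
  proof (rule SUP_least, clarify)
    fix n and x :: "nat \<Rightarrow> real"
    assume x: "\<forall>i\<le>n. x i \<in> {a..T}" "\<forall>i<n. x i \<le> x (Suc i)"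
    have e: "F (min b z) = F z" for z using const'[of z] by (cases "b \<le> z") (simp_all add: min_def)
    have m: "(n, \<lambda>i. min b (x i)) \<in> ?P {a..b}"
      using x \<open>a \<le> b\<close> by (auto intro!: min.mono)
    have "?S (n, \<lambda>i. min b (x i)) \<le> (SUP p\<in>?P {a..b}. ?S p)"
      by (rule SUP_upper[OF m])
    then show "(\<Sum>i<n. ennreal \<bar>F (x (Suc i)) - F (x i)\<bar>) \<le> (SUP p\<in>?P {a..b}. ?S p)"
      by (simp only: split e)
  qed
  with bv show "bounded_variation_on F {a..T}"
    by (auto simp: bounded_variation_on_def)
qed

lemma NBV_loc_loc_bv: "F \<in> NBV_loc \<Longrightarrow> loc_bv F"
  by (rule loc_bv_if_bounded_variation_on[of 0 F 0]) (auto simp: NBV_loc_def)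

lemma mono_tendsto_at_right:
  fixes f :: "real \<Rightarrow> real"
  assumes "mono f"
  shows "(f \<longlongrightarrow> Inf (f ` {x<..})) (at_right x)"
proof (rule order_tendstoI)
  have bdd: "bdd_below (f ` {x<..})"
    by (rule bdd_belowI[of _ "f x"]) (use assms in \<open>auto simp: mono_def\<close>)
  fix l assume l: "l < Inf (f ` {x<..})"
  show "\<forall>\<^sub>F y in at_right x. l < f y"
    using eventually_at_right_less[of x]
  proof eventually_elim
    case (elim y)
    then have "Inf (f ` {x<..}) \<le> f y" by (intro cInf_lower bdd) auto
    with l show ?case by simp
  qed
next
  fix u assume "Inf (f ` {x<..}) < u"
  then obtain y where y: "x < y" "f y < u"
    using cInf_lessD[of "f ` {x<..}" u] by auto
  show "\<forall>\<^sub>F y in at_right x. f y < u"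
    using eventually_at_right_real[OF y(1)]
  proof eventually_elim
    case (elim z)
    then have "f z \<le> f y" using assms by (auto simp: mono_def)
    with y show ?case by simp
  qed
qed

text \<open>
  For \<open>y\<close> close to \<open>x\<close>, the value \<open>G y\<close> is itself a limit of values of \<open>F\<close> at points close to \<open>x\<close>.
\<close>

lemma right_limits_right_continuous:
  fixes F G :: "real \<Rightarrow> real"
  assumes "\<And>x. (F \<longlongrightarrow> G x) (at_right x)"
  shows "(G \<longlongrightarrow> G x) (at_right x)"
proof (rule tendstoI)
  fix e :: real assume "0 < e"
  then have "\<forall>\<^sub>F y in at_right x. dist (F y) (G x) < e/2"
    using assms[of x] by (intro tendstoD) auto
  then obtain b where b: "x < b" "\<And>y. x < y \<Longrightarrow> y < b \<Longrightarrow> dist (F y) (G x) < e/2"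
    by (auto simp: eventually_at_right_field)
  show "\<forall>\<^sub>F y in at_right x. dist (G y) (G x) < e"
    using eventually_at_right_real[OF b(1)]
  proof eventually_elim
    case (elim y)
    then have "y < b" by simp
    have "\<forall>\<^sub>F z in at_right y. dist (F z) (G x) \<le> e/2"
      using eventually_at_right_real[OF \<open>y < b\<close>]
    proof eventually_elim
      case (elim z)
      with \<open>y \<in> {x<..<b}\<close> b(2)[of z] show ?case by (simp add: less_imp_le)
    qed
    moreover have "((\<lambda>z. dist (F z) (G x)) \<longlongrightarrow> dist (G y) (G x)) (at_right y)"
      by (intro tendsto_intros assms)
    ultimately have "dist (G y) (G x) \<le> e/2"
      by (intro tendsto_upperbound) auto
    with \<open>0 < e\<close> show ?case by simp
  qed
qed

text \<open>
  Right limits exist because the function is a difference of two increasing ones.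
\<close>

lemma right_lim_tendsto:
  assumes "loc_bv F"
  shows "(F \<longlongrightarrow> right_lim F x) (at_right x)"
proof -
  obtain w where w: "mono w" "mono (\<lambda>x. w x - F x)"
    using assms by (rule loc_bvE) blast
  have "((\<lambda>y. w y - (w y - F y)) \<longlongrightarrow> Inf (w ` {x<..}) - Inf ((\<lambda>x. w x - F x) ` {x<..})) (at_right x)"
    by (intro tendsto_diff mono_tendsto_at_right w)
  then have *: "(F \<longlongrightarrow> Inf (w ` {x<..}) - Inf ((\<lambda>x. w x - F x) ` {x<..})) (at_right x)" by simp
  then have "right_lim F x = Inf (w ` {x<..}) - Inf ((\<lambda>x. w x - F x) ` {x<..})"
    unfolding right_lim_def by (intro tendsto_Lim) auto
  with * show ?thesis by simp
qed

lemma right_lim_eqI: "(F \<longlongrightarrow> l) (at_right x) \<Longrightarrow> right_lim F x = l"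
  unfolding right_lim_def by (intro tendsto_Lim) auto

lemma right_lim_eq: "continuous (at_right x) F \<Longrightarrow> right_lim F x = F x"
  by (rule right_lim_eqI) (simp add: continuous_within)

lemma right_lim_cong:
  assumes "x < b" "\<And>y. x < y \<Longrightarrow> y < b \<Longrightarrow> F y = G y"
  shows "right_lim F x = right_lim G x"
proof -
  have "(F \<longlongrightarrow> l) (at_right x) \<longleftrightarrow> (G \<longlongrightarrow> l) (at_right x)" for l
    using assms
    by (intro tendsto_cong) (auto simp: eventually_at_right_field)
  then show ?thesis unfolding right_lim_def Topological_Spaces.Lim_def by simp
qed

lemma right_lim_below:
  assumes "\<And>x. x \<le> c \<Longrightarrow> F x = k" "x < c"
  shows "right_lim F x = k"
proof -
  have "right_lim F x = right_lim (\<lambda>_. k) x"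
    using assms by (intro right_lim_cong[of _ c]) auto
  then show ?thesis by (simp add: right_lim_eq)
qed

lemma right_lim_above:
  assumes "\<And>x. x \<ge> c \<Longrightarrow> F x = k" "c \<le> x"
  shows "right_lim F x = k"
proof -
  have "right_lim F x = right_lim (\<lambda>_. k) x"
    using assms by (intro right_lim_cong[of _ "x+1"]) auto
  then show ?thesis by (simp add: right_lim_eq)
qed

lemma right_lim_majorant:
  assumes "loc_bv F" "loc_bv w"
    and w: "\<And>x y. x \<le> y \<Longrightarrow> \<bar>F y - F x\<bar> \<le> w y - w x" and "x \<le> y"
  shows "\<bar>right_lim F y - right_lim F x\<bar> \<le> right_lim w y - right_lim w x"
proof (cases "x = y")
  case False
  with \<open>x \<le> y\<close> have "x < y" by simp
  have shift: "((\<lambda>h. G (z + h)) \<longlongrightarrow> right_lim G z) (at_right 0)" if "loc_bv G" for G z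
    using right_lim_tendsto[OF that, of z] filterlim_at_right_to_0[of G "nhds (right_lim G z)" z]
    by (simp add: add.commute)
  show ?thesis
  proof (rule tendsto_le)
    show "((\<lambda>h. \<bar>F (y + h) - F (x + h)\<bar>) \<longlongrightarrow> \<bar>right_lim F y - right_lim F x\<bar>) (at_right 0)"
      by (intro tendsto_intros shift assms)
    show "((\<lambda>h. w (y + h) - w (x + h)) \<longlongrightarrow> right_lim w y - right_lim w x) (at_right 0)"
      by (intro tendsto_intros shift assms)
    show "\<forall>\<^sub>F h in at_right 0. \<bar>F (y + h) - F (x + h)\<bar> \<le> w (y + h) - w (x + h)"
      using \<open>x < y\<close> by (auto intro!: always_eventually w)
  qed simp
qed simp

lemma loc_bv_right_lim:
  assumes "loc_bv F"
  shows "loc_bv (right_lim F)"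
proof -
  obtain w c where w: "\<And>x. x \<le> c \<Longrightarrow> w x = 0" "\<And>x y. x \<le> y \<Longrightarrow> \<bar>F y - F x\<bar> \<le> w y - w x" "mono w"
    using assms by (rule loc_bvE) blast
  have lw: "loc_bv w" using w(3,1) by (rule loc_bv_mono)
  show ?thesis
  proof (rule loc_bvI[of "c-1" "right_lim w"])
    show "right_lim w x = 0" if "x \<le> c - 1" for x
      using right_lim_below[of c w 0 x] w(1) that by simp
  qed (rule right_lim_majorant[OF assms lw w(2)])
qed

lemma right_lim_right_cont:
  assumes "loc_bv F"
  shows "continuous (at_right x) (right_lim F)"
  using right_limits_right_continuous[OF right_lim_tendsto[OF assms]]
  by (simp add: continuous_within)

lemma variation_right_lim_finite:
  assumes "loc_bv F"
  shows "variation (right_lim F) {..t} < \<infinity>"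
proof -
  obtain w c where w: "\<And>x. x \<le> c \<Longrightarrow> w x = 0"
    "\<And>x y. x \<le> y \<Longrightarrow> \<bar>right_lim F y - right_lim F x\<bar> \<le> w y - w x" "mono w"
    using loc_bv_right_lim[OF assms] by (rule loc_bvE) blast
  have "variation (right_lim F) {..t} \<le> ennreal (w t - 0)"
  proof (rule variation_upper_bound)
    fix x assume "x \<in> {..t}"
    moreover have "0 \<le> w x"
      using w(1)[of x] w(1)[of c] monoD[OF w(3), of c x] by (cases "x \<le> c") auto
    ultimately show "0 \<le> w x \<and> w x \<le> w t" using w(3) by (auto simp: mono_def)
  qed (use w in auto)
  also have "\<dots> < \<infinity>" by simp
  finally show ?thesis .
qed

lemma variation_fun_majorant:
  assumes "loc_bv F" "x \<le> y"
  shows "\<bar>right_lim F y - right_lim F x\<bar> \<le> variation_fun F y - variation_fun F x"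
proof -
  let ?G = "right_lim F"
  have "variation ?G {..x} + ennreal \<bar>?G y - ?G x\<bar> \<le> variation ?G {..y}"
    using assms by (intro variation_extend) auto
  then have "enn2real (variation ?G {..x} + ennreal \<bar>?G y - ?G x\<bar>) \<le> variation_fun F y"
    unfolding variation_fun_def
    using variation_right_lim_finite[OF assms(1)] by (intro enn2real_mono) auto
  also have "enn2real (variation ?G {..x} + ennreal \<bar>?G y - ?G x\<bar>) = variation_fun F x + \<bar>?G y - ?G x\<bar>"
    unfolding variation_fun_def
    using variation_right_lim_finite[OF assms(1)] by (subst enn2real_plus) auto
  finally show ?thesis by simp
qed

lemma variation_fun_mono: "loc_bv F \<Longrightarrow> mono (variation_fun F)"
  using variation_fun_majorant[of F] by (force simp: mono_def)

text \<open>
  The variation function is the smallest majorant: the sum over a partition telescopes when each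
  increment is replaced by that of \<open>w\<close>.
\<close>

lemma variation_fun_minimal:
  assumes "\<And>x y. x \<le> y \<Longrightarrow> y \<le> t \<Longrightarrow> \<bar>right_lim F y - right_lim F x\<bar> \<le> w y - w x"
    and "\<And>x. x \<le> t \<Longrightarrow> m \<le> w x"
  shows "variation_fun F t \<le> w t - m"
proof -
  have "variation (right_lim F) {..t} \<le> ennreal (w t - m)"
  proof (rule variation_upper_bound)
    fix x assume "x \<in> {..t}"
    then show "m \<le> w x \<and> w x \<le> w t" using assms(1)[of x t] assms(2)[of x] by auto
  qed (use assms in auto)
  then show ?thesis
    unfolding variation_fun_def using assms(2)[of t] by (intro enn2real_leI) auto
qed

lemma variation_fun_nonneg: "0 \<le> variation_fun F t"
  by (simp add: variation_fun_def)

lemma variation_fun_eq_0: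
  assumes "\<And>x. x \<le> t \<Longrightarrow> right_lim F x = k"
  shows "variation_fun F t = 0"
proof -
  have "variation_fun F t \<le> 0 - 0"
    using assms by (intro variation_fun_minimal[of t F "\<lambda>_. 0"]) auto
  then show ?thesis using variation_fun_nonneg[of F t] by simp
qed

text \<open>
  Stopping the variation function at \<open>b\<close> still gives a majorant, so minimality applies.
\<close>

lemma variation_fun_const_above:
  assumes F: "loc_bv F" and "\<And>x. x \<ge> b \<Longrightarrow> right_lim F x = k" "t \<ge> b"
  shows "variation_fun F t = variation_fun F b"
proof -
  have e: "right_lim F (min x b) = right_lim F x" for x
    using assms(2)[of x] assms(2)[of b] by (simp add: min_def)
  have "variation_fun F t \<le> variation_fun F (min t b) - 0"
  proof (rule variation_fun_minimal)
    fix x y :: real assume "x \<le> y"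
    then show "\<bar>right_lim F y - right_lim F x\<bar> \<le> variation_fun F (min y b) - variation_fun F (min x b)"
      using variation_fun_majorant[OF F, of "min x b" "min y b"] by (simp add: e)
  qed (rule variation_fun_nonneg)
  with \<open>t \<ge> b\<close> have "variation_fun F t \<le> variation_fun F b" by (simp add: min_absorb2)
  moreover have "variation_fun F b \<le> variation_fun F t"
    using variation_fun_mono[OF F] \<open>t \<ge> b\<close> by (simp add: mono_def)
  ultimately show ?thesis by simp
qed

text \<open>
  Minimality replaces the usual refinement of partitions. Let \<open>l\<close> be the right limit of the
  variation function \<open>v\<close> at \<open>s\<close>. Removing a possible jump \<open>l - v s\<close>, that is, lowering \<open>v\<close> by this amount to the
  right of \<open>s\<close>, leaves a majorant, because \<open>G\<close> itself is right-continuous at \<open>s\<close>. As \<open>v\<close> is the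
  smallest majorant, the jump is zero.
\<close>

lemma variation_fun_right_cont:
  assumes F: "loc_bv F"
  shows "continuous (at_right s) (variation_fun F)"
proof -
  let ?G = "right_lim F" and ?v = "variation_fun F"
  define l where "l = Inf (?v ` {s<..})"
  have lim: "(?v \<longlongrightarrow> l) (at_right s)"
    unfolding l_def by (rule mono_tendsto_at_right[OF variation_fun_mono[OF F]])
  have mono: "x \<le> y \<Longrightarrow> ?v x \<le> ?v y" for x y using variation_fun_mono[OF F] by (simp add: mono_def)
  have ge: "?v s \<le> l"
    unfolding l_def by (rule cINF_greatest) (auto intro!: mono)
  \<comment> \<open>the candidate for a smaller majorant: \<open>v\<close> without its jump at \<open>s\<close>\<close>
  define w where "w t = (if t \<le> s then ?v t else ?v t - (l - ?v s))" for t
  \<comment> \<open>across \<open>s\<close> the majorant property survives, by letting \<open>y\<close> tend to \<open>s\<close> in the one between \<open>y\<close> and \<open>t\<close>\<close>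
  have cross: "\<bar>?G t - ?G s\<bar> \<le> ?v t - l" if "s < t" for t
  proof (rule tendsto_le)
    show "((\<lambda>y. \<bar>?G t - ?G y\<bar>) \<longlongrightarrow> \<bar>?G t - ?G s\<bar>) (at_right s)"
      using right_lim_right_cont[OF F, of s] by (intro tendsto_intros) (simp add: continuous_within)
    show "((\<lambda>y. ?v t - ?v y) \<longlongrightarrow> ?v t - l) (at_right s)"
      by (intro tendsto_intros lim)
    show "\<forall>\<^sub>F y in at_right s. \<bar>?G t - ?G y\<bar> \<le> ?v t - ?v y"
      using eventually_at_right_real[OF that]
      by eventually_elim (auto intro!: variation_fun_majorant[OF F])
  qed simp
  have "?v t \<le> w t - 0" if "s < t" for t
  proof (rule variation_fun_minimal)
    fix x y :: real assume "x \<le> y"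
    then consider "y \<le> s" | "x \<le> s" "s < y" | "s < x" by linarith
    then show "\<bar>?G y - ?G x\<bar> \<le> w y - w x"
    proof cases
      case 2
      with cross[of y] variation_fun_majorant[OF F, of x s] show ?thesis by (simp add: w_def)
    qed (use variation_fun_majorant[OF F, of x y] \<open>x \<le> y\<close> in \<open>simp_all add: w_def\<close>)
  next
    fix x assume "x \<le> t"
    show "0 \<le> w x"
      using variation_fun_nonneg[of F x] variation_fun_nonneg[of F s] cross[of x] by (auto simp: w_def)
  qed
  from this[of "s+1"] have "l \<le> ?v s" by (simp add: w_def)
  with ge lim show ?thesis by (simp add: continuous_within)
qed

section \<open>The two increasing measures of a function\<close>

text \<open>
  These are the measures that have a finite distribution function \<open>x \<mapsto> M(-\<infinity>, x]\<close> vanishing near \<open>-\<infinity>\<close>.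
\<close>

definition lower_finite :: "real measure \<Rightarrow> bool" where
  "lower_finite M \<longleftrightarrow> sets M = sets borel \<and> (\<forall>x. emeasure M {..x} \<noteq> \<infinity>) \<and> (\<exists>c. emeasure M {..<c} = 0)"

lemma emeasure_interval_measure_Iic:
  assumes mono: "mono P" and rc: "\<And>a. continuous (at_right a) P"
    and k: "\<And>x. x < c \<Longrightarrow> P x = k"
  shows "emeasure (interval_measure P) {..x} = ennreal (P x - k)"
proof -
  let ?M = "interval_measure P"
  have le: "P x \<le> P y" if "x \<le> y" for x y using mono that by (simp add: mono_def)
  have "(\<lambda>n. emeasure ?M {x - real n<..x}) \<longlonglongrightarrow> emeasure ?M (\<Union>n. {x - real n<..x})"
    by (intro Lim_emeasure_incseq) (auto simp: incseq_def)
  moreover have "(\<Union>n. {x - real n<..x}) = {..x}"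
  proof -
    have "\<exists>n. x - real n < y" for y
      using reals_Archimedean2[of "x - y"] by (auto simp: algebra_simps)
    then show ?thesis by auto
  qed
  moreover have "\<forall>\<^sub>F n in sequentially. emeasure ?M {x - real n<..x} = ennreal (P x - k)"
  proof -
    obtain N :: nat where N: "x - c < real N" using reals_Archimedean2 by blast
    show ?thesis
      using eventually_ge_at_top[of N]
    proof eventually_elim
      case (elim n)
      then have "x - real n < c" using N by linarith
      then show ?case using emeasure_interval_measure_Ioc[of "x - real n" x P] le rc k by simp
    qed
  qed
  then have "(\<lambda>n. emeasure ?M {x - real n<..x}) \<longlonglongrightarrow> ennreal (P x - k)"
    by (rule tendsto_eventually)
  ultimately show ?thesis using LIMSEQ_unique by metis
qed

lemma emeasure_interval_measure_lower_null:
  assumes mono: "mono P" and rc: "\<And>a. continuous (at_right a) P"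
    and k: "\<And>x. x < c \<Longrightarrow> P x = k"
  shows "emeasure (interval_measure P) {..<c} = 0"
proof -
  let ?M = "interval_measure P"
  have "(\<Union>n. {..c - 1 / real (Suc n)}) \<in> null_sets ?M"
  proof (rule null_sets_UN)
    fix n
    show "{..c - 1 / real (Suc n)} \<in> null_sets ?M"
      using emeasure_interval_measure_Iic[OF mono rc k, where c=c and x="c - 1 / real (Suc n)"] k
      by (intro null_setsI) simp_all
  qed
  moreover have "{..<c} \<subseteq> (\<Union>n. {..c - 1 / real (Suc n)})"
  proof
    fix x assume "x \<in> {..<c}"
    then have "0 < c - x" by simp
    then obtain n where "inverse (real (Suc n)) < c - x" using reals_Archimedean by blast
    then show "x \<in> (\<Union>n. {..c - 1 / real (Suc n)})"
      by (auto intro!: exI[of _ n] simp: inverse_eq_divide)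
  qed
  ultimately have "{..<c} \<in> null_sets ?M" by (intro null_sets_subset[of _ ?M "{..<c}"]) simp_all
  then show ?thesis by (simp add: null_setsD1)
qed

lemma lower_finite_interval_measure:
  assumes mono: "mono P" and rc: "\<And>a. continuous (at_right a) P"
    and k: "\<And>x. x < c \<Longrightarrow> P x = k"
  shows "lower_finite (interval_measure P)"
  unfolding lower_finite_def
  using emeasure_interval_measure_Iic[OF mono rc k, where c=c] emeasure_interval_measure_lower_null[OF mono rc k, where c=c] by auto

definition pos_measure :: "(real \<Rightarrow> real) \<Rightarrow> real measure" where
  "pos_measure F = interval_measure (variation_fun F)"

definition neg_measure :: "(real \<Rightarrow> real) \<Rightarrow> real measure" where
  "neg_measure F = interval_measure (\<lambda>t. variation_fun F t - right_lim F t)"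

lemma sets_pos_measure [simp, measurable_cong]: "sets (pos_measure F) = sets borel"
  and sets_neg_measure [simp, measurable_cong]: "sets (neg_measure F) = sets borel"
  and space_pos_measure [simp]: "space (pos_measure F) = UNIV" and space_neg_measure [simp]: "space (neg_measure F) = UNIV"
  by (simp_all add: pos_measure_def neg_measure_def)

definition signed_int :: "(real \<Rightarrow> real) \<Rightarrow> (real \<Rightarrow> real) \<Rightarrow> real" where
  "signed_int F h = integral\<^sup>L (pos_measure F) h - integral\<^sup>L (neg_measure F) h"

text \<open>
  A statement holds eventually for this filter if it holds almost everywhere for the positive and for the
  negative measure. The two measures need not be mutually singular, so this is the right notion of null
  set for the pair of integrals in \<open>signed_int\<close>.
\<close>

definition ae_both :: "(real \<Rightarrow> real) \<Rightarrow> real filter" where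
  "ae_both F = sup (ae_filter (pos_measure F)) (ae_filter (neg_measure F))"

lemma eventually_ae_both: "eventually P (ae_both F) \<longleftrightarrow> (AE x in pos_measure F. P x) \<and> (AE x in neg_measure F. P x)"
  by (simp add: ae_both_def eventually_sup)

lemma stieltjes_eq_signed_int: "stieltjes F A g = signed_int F (\<lambda>x. indicator A x * g x)"
  by (simp add: stieltjes_def signed_int_def pos_measure_def neg_measure_def set_lebesgue_integral_def)

context
  fixes F assumes F: "loc_bv F"
begin

lemma neg_part_mono: "mono (\<lambda>t. variation_fun F t - right_lim F t)"
proof (rule monoI)
  fix x y :: real assume "x \<le> y"
  then show "variation_fun F x - right_lim F x \<le> variation_fun F y - right_lim F y"
    using variation_fun_majorant[OF F, of x y] by linarith
qed

lemma neg_part_right_cont: "continuous (at_right a) (\<lambda>t. variation_fun F t - right_lim F t)"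
  by (intro continuous_intros variation_fun_right_cont right_lim_right_cont F)

lemma emeasure_pos_neg_Iic:
  assumes "\<And>x. x < c \<Longrightarrow> right_lim F x = k"
  shows "emeasure (pos_measure F) {..x} = ennreal (variation_fun F x)"
    and "emeasure (neg_measure F) {..x} = ennreal (variation_fun F x - right_lim F x + k)"
proof -
  have v: "variation_fun F x = 0" if "x < c" for x
    using assms that by (intro variation_fun_eq_0) auto
  show "emeasure (pos_measure F) {..x} = ennreal (variation_fun F x)"
    unfolding pos_measure_def
    using emeasure_interval_measure_Iic[OF variation_fun_mono[OF F] variation_fun_right_cont[OF F] v, where c=c and x=x] by simp
  show "emeasure (neg_measure F) {..x} = ennreal (variation_fun F x - right_lim F x + k)"
    unfolding neg_measure_def
    using emeasure_interval_measure_Iic[OF neg_part_mono neg_part_right_cont, of c "-k" x] assms v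
    by simp
qed

lemma measure_pos_neg_Iic:
  assumes "\<And>x. x < c \<Longrightarrow> right_lim F x = k"
  shows "measure (pos_measure F) {..x} = variation_fun F x"
    and "measure (neg_measure F) {..x} = variation_fun F x - right_lim F x + k"
proof -
  show "measure (pos_measure F) {..x} = variation_fun F x"
    using emeasure_pos_neg_Iic[OF assms, where c=c and x=x] variation_fun_nonneg[of F x] by (simp add: measure_def)
  have "right_lim F (min x (c - 1)) = k" using assms by simp
  moreover have "variation_fun F (min x (c - 1)) = 0"
    using assms by (intro variation_fun_eq_0) auto
  ultimately have "0 \<le> variation_fun F x - right_lim F x + k"
    using monoD[OF neg_part_mono, of "min x (c - 1)" x] by simp
  then show "measure (neg_measure F) {..x} = variation_fun F x - right_lim F x + k"
    using emeasure_pos_neg_Iic[OF assms, where c=c and x=x] by (simp add: measure_def)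
qed

lemma right_lim_const_below: "\<exists>c k. \<forall>x<c. right_lim F x = k"
proof -
  obtain c k where "\<And>x. x \<le> c \<Longrightarrow> F x = k" using F by (rule loc_bvE) blast
  then have "right_lim F x = k" if "x < c" for x using right_lim_below[of c F k] that by blast
  then show ?thesis by blast
qed

lemma null_below:
  assumes c: "\<And>x. x < c \<Longrightarrow> right_lim F x = k"
  shows "\<forall>\<^sub>F x in ae_both F. c \<le> x"
proof -
  have v: "variation_fun F x = 0" if "x < c" for x
    using assms that by (intro variation_fun_eq_0) auto
  have "emeasure (pos_measure F) {..<c} = 0"
    unfolding pos_measure_def
    by (rule emeasure_interval_measure_lower_null[OF variation_fun_mono[OF F] variation_fun_right_cont[OF F] v])
  moreover have "emeasure (neg_measure F) {..<c} = 0"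
    unfolding neg_measure_def
    by (rule emeasure_interval_measure_lower_null[OF neg_part_mono neg_part_right_cont, of c "-k"])
       (simp add: v c)
  ultimately show ?thesis
    unfolding eventually_ae_both by (auto intro!: AE_I[where N = "{..<c}"])
qed

text \<open>
  With the non-strict inequality in the assumption the point \<open>c\<close> carries no mass either.
\<close>

lemma null_below_le:
  assumes c: "\<And>x. x \<le> c \<Longrightarrow> right_lim F x = k"
  shows "\<forall>\<^sub>F x in ae_both F. c < x"
proof -
  have "variation_fun F c = 0" using c by (intro variation_fun_eq_0) auto
  then have "emeasure (pos_measure F) {..c} = 0" "emeasure (neg_measure F) {..c} = 0"
    using emeasure_pos_neg_Iic[of c k c] c by simp_all
  then show ?thesis
    unfolding eventually_ae_both by (auto intro!: AE_I[where N = "{..c}"])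
qed

lemma lower_finite_pos_measure: "lower_finite (pos_measure F)" and lower_finite_neg_measure: "lower_finite (neg_measure F)"
proof -
  obtain c k where ck: "\<And>x. x < c \<Longrightarrow> right_lim F x = k" using right_lim_const_below by blast
  have v: "variation_fun F x = 0" if "x < c" for x
    using ck that by (intro variation_fun_eq_0) auto
  show "lower_finite (pos_measure F)" unfolding pos_measure_def
    by (rule lower_finite_interval_measure[OF variation_fun_mono[OF F] variation_fun_right_cont[OF F] v])
  show "lower_finite (neg_measure F)" unfolding neg_measure_def
    by (rule lower_finite_interval_measure[OF neg_part_mono neg_part_right_cont, of c "-k"]) (simp add: v ck)
qed

text \<open>
  Both distribution functions are constant on \<open>[b, \<infinity>)\<close>, so the bounded intervals to the right of \<open>b\<close> are null.
\<close>

lemma null_above: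
  assumes b: "\<And>x. x \<ge> b \<Longrightarrow> right_lim F x = k"
  shows "\<forall>\<^sub>F x in ae_both F. x \<le> b"
proof -
  obtain c l where ck: "\<And>x. x < c \<Longrightarrow> right_lim F x = l" using right_lim_const_below by blast
  have v: "variation_fun F x = variation_fun F b" if "b \<le> x" for x
    using variation_fun_const_above[OF F b that] by simp
  have null: "{b<..} \<in> null_sets M" if M: "lower_finite M" "\<And>n::nat. emeasure M {..b + real n} = emeasure M {..b}" for M
  proof -
    have [simp]: "sets M = sets borel" and fin: "emeasure M {..b} \<noteq> \<infinity>"
      using M(1) by (auto simp: lower_finite_def)
    have "emeasure M ({..b + real n} - {..b}) = 0" for n
      using M(2)[of n] fin by (subst emeasure_Diff) auto
    moreover have "{..b + real n} - {..b} = {b<..b + real n}" for n by auto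
    ultimately have "(\<Union>n::nat. {b<..b + real n}) \<in> null_sets M"
      by (intro null_sets_UN null_setsI) auto
    moreover have "(\<Union>n::nat. {b<..b + real n}) = {b<..}"
    proof -
      have "\<exists>n. y \<le> b + real n" for y
        using real_arch_simple[of "y - b"] by (auto simp: algebra_simps)
      then show ?thesis by auto
    qed
    ultimately show ?thesis by simp
  qed
  have "emeasure (pos_measure F) {..b + real n} = emeasure (pos_measure F) {..b}"
    "emeasure (neg_measure F) {..b + real n} = emeasure (neg_measure F) {..b}" for n
    using emeasure_pos_neg_Iic[OF ck, where c=c and x="b + real n"] emeasure_pos_neg_Iic[OF ck, where c=c and x=b]
      v[of "b + real n"] b[of b] b[of "b + real n"] by simp_all
  with lower_finite_pos_measure lower_finite_neg_measure null
  have "{b<..} \<in> null_sets (pos_measure F)" "{b<..} \<in> null_sets (neg_measure F)" by blast+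
  then show ?thesis
    unfolding eventually_ae_both by (auto intro: AE_I')
qed

end

lemma lower_finite_integrable:
  fixes h :: "real \<Rightarrow> real"
  assumes M: "lower_finite M" and h: "h \<in> borel_measurable borel"
    and b: "AE x in M. \<bar>h x\<bar> \<le> C * indicator {..b} x"
  shows "integrable M h"
proof (rule Bochner_Integration.integrable_bound)
  have s[measurable_cong, simp]: "sets M = sets borel" using M by (simp add: lower_finite_def)
  show "integrable M (\<lambda>x. C * indicator {..b} x :: real)"
    using M by (intro integrable_mult_right integrable_real_indicator) (auto simp: lower_finite_def less_top)
  show "h \<in> borel_measurable M" using h by simp
  show "AE x in M. norm (h x) \<le> norm (C * indicator {..b} x)"
    using b by eventually_elim auto
qed

lemma lower_finite_sigma_finite:
  assumes M: "lower_finite M" shows "sigma_finite_measure M"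
proof
  have s: "sets M = sets borel" using M by (simp add: lower_finite_def)
  then have sp: "space M = UNIV" using sets_eq_imp_space_eq by fastforce
  have "\<exists>n. y \<le> real n" for y using real_arch_simple by blast
  then show "\<exists>A. countable A \<and> A \<subseteq> sets M \<and> \<Union> A = space M \<and> (\<forall>a\<in>A. emeasure M a \<noteq> \<infinity>)"
    using M by (intro exI[of _ "range (\<lambda>n::nat. {..real n})"]) (auto simp: s sp lower_finite_def)
qed

lemma lower_finite_Iic_measurable:
  assumes M: "lower_finite M"
  shows "mono (\<lambda>x. measure M {..x})" "(\<lambda>x. measure M {..t - x}) \<in> borel_measurable borel"
proof -
  have *: "measure M {..x} \<le> measure M {..y}" if "x \<le> y" for x y
    using M that by (intro measure_mono_fmeasurable) (auto simp: lower_finite_def fmeasurable_def less_top)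
  then show m: "mono (\<lambda>x. measure M {..x})" by (simp add: mono_def)
  show "(\<lambda>x. measure M {..t - x}) \<in> borel_measurable borel"
    using measurable_compose[OF _ borel_measurable_mono[OF m], of "\<lambda>x. t - x" borel] by simp
qed

text \<open>
  Fubini: both sides are the product measure of the half-plane \<open>x + y \<le> t\<close>.
\<close>

lemma measure_convolution_commute:
  assumes M: "lower_finite M" and N: "lower_finite N"
  shows "(\<integral>x. measure M {..t - x} \<partial>N) = (\<integral>x. measure N {..t - x} \<partial>M)"
proof -
  have s[measurable_cong, simp]: "sets M = sets borel" "sets N = sets borel"
    using M N by (auto simp: lower_finite_def)
  interpret M: sigma_finite_measure M by (rule lower_finite_sigma_finite[OF M])
  interpret N: sigma_finite_measure N by (rule lower_finite_sigma_finite[OF N])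
  interpret P: pair_sigma_finite N M by standard
  let ?S = "{p::real\<times>real. fst p + snd p \<le> t}"
  have "?S \<in> sets (borel \<Otimes>\<^sub>M borel)"
  proof -
    have "{p \<in> space (borel \<Otimes>\<^sub>M borel). fst p + snd p \<le> t} \<in> sets (borel \<Otimes>\<^sub>M (borel :: real measure))"
      by measurable
    then show ?thesis by (simp add: space_pair_measure)
  qed
  then have S: "?S \<in> sets (N \<Otimes>\<^sub>M M)"
    using sets_pair_measure_cong[OF s(2) s(1)] by simp
  have "(\<integral>\<^sup>+x. emeasure M {..t - x} \<partial>N) = emeasure (N \<Otimes>\<^sub>M M) ?S"
    unfolding M.emeasure_pair_measure_alt[OF S]
    by (intro nn_integral_cong arg_cong2[of _ _ _ _ emeasure]) auto
  also have "\<dots> = (\<integral>\<^sup>+x. emeasure N {..t - x} \<partial>M)"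
    unfolding P.emeasure_pair_measure_alt2[OF S]
    by (intro nn_integral_cong arg_cong2[of _ _ _ _ emeasure]) auto
  finally have eq: "(\<integral>\<^sup>+x. emeasure M {..t - x} \<partial>N) = (\<integral>\<^sup>+x. emeasure N {..t - x} \<partial>M)" .
  have e: "emeasure M {..x} = ennreal (measure M {..x})" "emeasure N {..x} = ennreal (measure N {..x})" for x
    using M N by (auto simp: lower_finite_def intro!: emeasure_eq_ennreal_measure)
  have "(\<integral>x. measure M {..t - x} \<partial>N) = enn2real (\<integral>\<^sup>+x. emeasure M {..t - x} \<partial>N)"
    unfolding e using lower_finite_Iic_measurable[OF M] by (intro integral_eq_nn_integral) auto
  also have "\<dots> = (\<integral>x. measure N {..t - x} \<partial>M)"
    unfolding eq unfolding e using lower_finite_Iic_measurable[OF N]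
    by (intro integral_eq_nn_integral[symmetric]) auto
  finally show ?thesis .
qed

section \<open>Signed integrals and convolutions\<close>

definition abs_integrable :: "(real \<Rightarrow> real) \<Rightarrow> (real \<Rightarrow> real) \<Rightarrow> bool" where
  "abs_integrable F h \<longleftrightarrow> h \<in> borel_measurable borel \<and> integrable (pos_measure F) h \<and> integrable (neg_measure F) h"

lemma abs_integrable_measurable [measurable_dest]: "abs_integrable F h \<Longrightarrow> h \<in> borel_measurable borel"
  by (simp add: abs_integrable_def)

lemma signed_int_add: "abs_integrable F g \<Longrightarrow> abs_integrable F h \<Longrightarrow> signed_int F (\<lambda>x. g x + h x) = signed_int F g + signed_int F h"
  by (simp add: signed_int_def abs_integrable_def)

lemma signed_int_diff: "abs_integrable F g \<Longrightarrow> abs_integrable F h \<Longrightarrow> signed_int F (\<lambda>x. g x - h x) = signed_int F g - signed_int F h"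
  by (simp add: signed_int_def abs_integrable_def)

lemma signed_int_cmult: "signed_int F (\<lambda>x. c * h x) = c * signed_int F h"
  by (simp add: signed_int_def algebra_simps)

lemma abs_integrable_add: "abs_integrable F g \<Longrightarrow> abs_integrable F h \<Longrightarrow> abs_integrable F (\<lambda>x. g x + h x)"
  by (auto simp: abs_integrable_def)

lemma abs_integrable_cmult: "abs_integrable F h \<Longrightarrow> abs_integrable F (\<lambda>x. c * h x)"
  by (auto simp: abs_integrable_def)

lemma signed_int_cong:
  assumes "\<forall>\<^sub>F x in ae_both F. g x = h x" "g \<in> borel_measurable borel" "h \<in> borel_measurable borel"
  shows "signed_int F g = signed_int F h"
proof -
  have "integral\<^sup>L (pos_measure F) g = integral\<^sup>L (pos_measure F) h" "integral\<^sup>L (neg_measure F) g = integral\<^sup>L (neg_measure F) h"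
    using assms by (intro integral_cong_AE; simp add: eventually_ae_both measurable_def)+
  then show ?thesis by (simp add: signed_int_def)
qed

lemma abs_integrableI:
  assumes F: "loc_bv F" and h: "h \<in> borel_measurable borel"
    and b: "\<forall>\<^sub>F x in ae_both F. \<bar>h x\<bar> \<le> C * indicator {..b} x"
  shows "abs_integrable F h"
  using assms lower_finite_integrable[OF lower_finite_pos_measure[OF F] h, of C b]
    lower_finite_integrable[OF lower_finite_neg_measure[OF F] h, of C b]
  by (simp add: abs_integrable_def eventually_ae_both)

lemma abs_integrable_Iic: "loc_bv F \<Longrightarrow> abs_integrable F (indicator {..b})"
  by (rule abs_integrableI[of F _ 1 b]) auto

lemma abs_integrable_indicator:
  assumes "loc_bv F" "A \<in> sets borel" "A \<subseteq> {..b}"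
  shows "abs_integrable F (indicator A)"
  using assms by (intro abs_integrableI[of F _ 1 b]) (auto intro!: always_eventually split: split_indicator)

lemma signed_int_Iic:
  assumes F: "loc_bv F" and c: "\<And>x. x < c \<Longrightarrow> right_lim F x = k"
  shows "signed_int F (indicator {..b}) = right_lim F b - k"
  using measure_pos_neg_Iic[OF F c, where c=c and x=b] by (simp add: signed_int_def)

lemma signed_int_Ioc:
  assumes F: "loc_bv F" and "a \<le> b"
  shows "signed_int F (indicator {a<..b}) = right_lim F b - right_lim F a"
proof -
  obtain c k where ck: "\<And>x. x < c \<Longrightarrow> right_lim F x = k"
    using right_lim_const_below[OF F] by blast
  have e: "indicator {a<..b} = (\<lambda>x. indicator {..b} x - indicator {..a} x :: real)"
    using \<open>a \<le> b\<close> by (auto simp: fun_eq_iff indicator_def)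
  show ?thesis
    unfolding e signed_int_diff[OF abs_integrable_Iic[OF F] abs_integrable_Iic[OF F]]
    using signed_int_Iic[OF F ck, where c=c] by simp
qed

text \<open>
  An upper bound of the total variation of the signed measure on \<open>(-\<infinity>, b]\<close>.
\<close>

definition mass_upto :: "(real \<Rightarrow> real) \<Rightarrow> real \<Rightarrow> real" where
  "mass_upto F b = measure (pos_measure F) {..b} + measure (neg_measure F) {..b}"

lemma signed_int_bound:
  assumes F: "loc_bv F" and h: "h \<in> borel_measurable borel"
    and b: "\<forall>\<^sub>F x in ae_both F. \<bar>h x\<bar> \<le> C * indicator {..b} x"
  shows "\<bar>signed_int F h\<bar> \<le> C * mass_upto F b"
proof -
  have a: "abs_integrable F h" using abs_integrableI[OF assms] .
  have *: "\<bar>integral\<^sup>L M h\<bar> \<le> C * measure M {..b}"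
    if M: "lower_finite M" "integrable M h" "AE x in M. \<bar>h x\<bar> \<le> C * indicator {..b} x" for M
  proof -
    have "\<bar>integral\<^sup>L M h\<bar> \<le> (\<integral>x. \<bar>h x\<bar> \<partial>M)" by (rule integral_abs_bound)
    also have "\<dots> \<le> (\<integral>x. C * indicator {..b} x \<partial>M)"
      using M by (intro integral_mono_AE integrable_abs integrable_mult_right integrable_real_indicator)
        (auto simp: lower_finite_def less_top)
    also have "\<dots> = C * measure M ({..b} \<inter> space M)" by simp
    also have "{..b} \<inter> space M = {..b}"
      using M(1) sets_eq_imp_space_eq[of M borel] by (simp add: lower_finite_def)
    finally show ?thesis .
  qed
  have "\<bar>signed_int F h\<bar> \<le> \<bar>integral\<^sup>L (pos_measure F) h\<bar> + \<bar>integral\<^sup>L (neg_measure F) h\<bar>"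
    by (simp add: signed_int_def)
  also have "\<dots> \<le> C * measure (pos_measure F) {..b} + C * measure (neg_measure F) {..b}"
    using a b by (intro add_mono * lower_finite_pos_measure lower_finite_neg_measure F) (auto simp: abs_integrable_def eventually_ae_both)
  finally show ?thesis by (simp add: mass_upto_def algebra_simps)
qed

lemma signed_int_tendsto:
  assumes h: "h \<in> borel_measurable borel" "\<And>n. g n \<in> borel_measurable borel" and w: "abs_integrable F w"
    and lim: "\<forall>\<^sub>F x in ae_both F. (\<lambda>n. g n x) \<longlonglongrightarrow> h x"
    and bd: "\<And>n. \<forall>\<^sub>F x in ae_both F. \<bar>g n x\<bar> \<le> w x"
  shows "(\<lambda>n. signed_int F (g n)) \<longlonglongrightarrow> signed_int F h"
  unfolding signed_int_def
  using assms
  by (intro tendsto_diff integral_dominated_convergence[of _ _ _ w]) (auto simp: eventually_ae_both abs_integrable_def)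

text \<open>
  The intervals \<open>(s - 1/n, s]\<close> shrink to \<open>{s}\<close>. In this form the lemma is used in both directions: to get
  left-continuity from a vanishing atom, and the converse.
\<close>

lemma jumps_tendsto_atom:
  assumes F: "loc_bv F"
  shows "(\<lambda>n. right_lim F s - right_lim F (s - 1 / real (Suc n))) \<longlonglongrightarrow> signed_int F (indicator {s})"
proof -
  have "(\<lambda>n. signed_int F (indicator {s - 1 / real (Suc n)<..s})) \<longlonglongrightarrow> signed_int F (indicator {s})"
  proof (rule signed_int_tendsto[where w = "indicator {..s}"])
    show "abs_integrable F (indicator {..s})" by (rule abs_integrable_Iic[OF F])
    have "(\<lambda>n. indicator {s - 1 / real (Suc n)<..s} x :: real) \<longlonglongrightarrow> indicator {s} x" for x
    proof (cases "x < s")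
      case True
      then obtain N where N: "inverse (real (Suc N)) < s - x" using reals_Archimedean[of "s - x"] by auto
      have "\<forall>\<^sub>F n in sequentially. indicator {s - 1 / real (Suc n)<..s} x = (indicator {s} x :: real)"
        using eventually_ge_at_top[of N]
      proof eventually_elim
        case (elim n)
        then have "1 / real (Suc n) \<le> inverse (real (Suc N))" by (simp add: field_simps)
        with N True show ?case by (simp add: indicator_def)
      qed
      then show ?thesis by (rule tendsto_eventually)
    next
      case False
      then have "indicator {s - 1 / real (Suc n)<..s} x = (indicator {s} x :: real)" for n
        by (simp add: indicator_def)
      then show ?thesis by simp
    qed
    then show "\<forall>\<^sub>F x in ae_both F. (\<lambda>n. indicator {s - 1 / real (Suc n)<..s} x :: real) \<longlonglongrightarrow> indicator {s} x"
      by (auto intro: always_eventually)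
  qed (auto intro!: always_eventually simp: indicator_def)
  moreover have "signed_int F (indicator {s - 1 / real (Suc n)<..s}) = right_lim F s - right_lim F (s - 1 / real (Suc n))" for n
    by (rule signed_int_Ioc[OF F]) simp
  ultimately show ?thesis by simp
qed

definition conv :: "(real \<Rightarrow> real) \<Rightarrow> (real \<Rightarrow> real) \<Rightarrow> real \<Rightarrow> real" where
  "conv F H t = signed_int H (\<lambda>x. F (t - x))"

lemma loc_bv_measurable:
  assumes "loc_bv F" shows "F \<in> borel_measurable borel"
proof -
  obtain w where "mono w" "mono (\<lambda>x. w x - F x)" using assms by (rule loc_bvE) blast
  then have "(\<lambda>x. w x - (w x - F x)) \<in> borel_measurable borel"
    by (intro borel_measurable_diff borel_measurable_mono)
  then show ?thesis by simp
qed

lemma loc_bv_reflect_measurable: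
  assumes "loc_bv F" shows "(\<lambda>x. F (t - x)) \<in> borel_measurable borel"
  using measurable_compose[OF _ loc_bv_measurable[OF assms], of "\<lambda>x. t - x" borel] by simp

definition vanishes_left :: "(real \<Rightarrow> real) \<Rightarrow> bool" where
  "vanishes_left F \<longleftrightarrow> (\<exists>c. \<forall>x<c. F x = 0)"

lemma vanishes_leftI: "(\<And>x. x < c \<Longrightarrow> F x = 0) \<Longrightarrow> vanishes_left F"
  by (auto simp: vanishes_left_def)

text \<open>
  Comparing with a point far to the left, where both \<open>F\<close> and the majorant of its increments vanish,
  shows that the latter also bounds \<open>\<bar>F\<bar>\<close>.
\<close>

lemma loc_bv_majorant:
  assumes "loc_bv F" "vanishes_left F"
  obtains w d where "mono w" "loc_bv w" "\<And>x y. x \<le> y \<Longrightarrow> \<bar>F y - F x\<bar> \<le> w y - w x"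
    "\<And>x. x < d \<Longrightarrow> w x = 0" "\<And>x. \<bar>F x\<bar> \<le> w x" "\<And>x. 0 \<le> w x"
proof -
  obtain w d where w: "\<And>x. x \<le> d \<Longrightarrow> w x = 0" "\<And>x y. x \<le> y \<Longrightarrow> \<bar>F y - F x\<bar> \<le> w y - w x" "mono w"
    using assms(1) by (rule loc_bvE) blast
  obtain c where c: "\<And>x. x < c \<Longrightarrow> F x = 0" using assms(2) by (auto simp: vanishes_left_def)
  have bd: "\<bar>F x\<bar> \<le> w x" for x
    using w(2)[of "min (c - 1) (min d x)" x] w(1)[of "min (c - 1) (min d x)"] c[of "min (c - 1) (min d x)"] by simp
  show ?thesis
  proof (rule that[of w d])
    show "0 \<le> w x" for x using bd[of x] by linarith
    show "loc_bv w" by (rule loc_bv_mono[OF w(3) w(1)])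
  qed (use w bd in auto)
qed

text \<open>
  The integrand vanishes for large \<open>x\<close>, and is bounded on the half-line that carries the measures of \<open>H\<close>.
\<close>

lemma abs_integrable_reflect:
  assumes F: "loc_bv F" "vanishes_left F" and H: "loc_bv H"
  shows "abs_integrable H (\<lambda>x. F (t - x))"
proof -
  obtain w d where w: "mono w" "loc_bv w" "\<And>x y. x \<le> y \<Longrightarrow> \<bar>F y - F x\<bar> \<le> w y - w x"
    "\<And>x. x < d \<Longrightarrow> w x = 0" "\<And>x. \<bar>F x\<bar> \<le> w x" "\<And>x. 0 \<le> w x"
    by (rule loc_bv_majorant[OF F]) (rule that)
  obtain a k where ak: "\<And>x. x < a \<Longrightarrow> right_lim H x = k"
    using right_lim_const_below[OF H] by blast
  then have supp: "\<forall>\<^sub>F x in ae_both H. a \<le> x" by (rule null_below[OF H])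
  show ?thesis
  proof (rule abs_integrableI[OF H loc_bv_reflect_measurable[OF F(1)]])
    show "\<forall>\<^sub>F x in ae_both H. \<bar>F (t - x)\<bar> \<le> w (t - a) * indicator {..t - d} x"
      using supp
    proof eventually_elim
      case (elim x)
      have "\<bar>F (t - x)\<bar> \<le> w (t - x)" by (rule w(5))
      also have "\<dots> \<le> w (t - a) * indicator {..t - d} x"
        using monoD[OF w(1), of "t - x" "t - a"] elim w(4)[of "t - x"] w(6)[of "t - a"] by (auto simp: indicator_def)
      finally show ?case .
    qed
  qed
qed

lemma conv_eq_0:
  assumes H: "\<forall>\<^sub>F x in ae_both H. a \<le> x" and F: "loc_bv F" "\<And>x. x \<le> c \<Longrightarrow> F x = 0" and t: "t \<le> a + c"
  shows "conv F H t = 0"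
proof -
  have "signed_int H (\<lambda>x. F (t - x)) = signed_int H (\<lambda>x. 0)"
  proof (rule signed_int_cong)
    show "\<forall>\<^sub>F x in ae_both H. F (t - x) = 0"
      using H by eventually_elim (use F(2) t in auto)
  qed (auto simp: loc_bv_reflect_measurable[OF F(1)])
  then show ?thesis by (simp add: conv_def signed_int_def)
qed

text \<open>
  If \<open>w\<close> is a majorant of \<open>F\<close>, then its convolution with the sum of the two measures of \<open>H\<close> is a majorant of
  the convolution.
\<close>

lemma conv_loc_bv:
  assumes F: "loc_bv F" "vanishes_left F" and H: "loc_bv H"
  shows "loc_bv (conv F H)"
proof -
  obtain w d where w: "mono w" "loc_bv w" "\<And>x y. x \<le> y \<Longrightarrow> \<bar>F y - F x\<bar> \<le> w y - w x"
    "\<And>x. x < d \<Longrightarrow> w x = 0" "\<And>x. \<bar>F x\<bar> \<le> w x" "\<And>x. 0 \<le> w x"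
    by (rule loc_bv_majorant[OF F]) (rule that)
  note maj = w(3)
  obtain a k where ak: "\<And>x. x < a \<Longrightarrow> right_lim H x = k"
    using right_lim_const_below[OF H] by blast
  then have supp: "\<forall>\<^sub>F x in ae_both H. a \<le> x" by (rule null_below[OF H])
  have "vanishes_left w" using w(4) by (rule vanishes_leftI)
  note intF = abs_integrable_reflect[OF F H] and intw = abs_integrable_reflect[OF w(2) this H]
  define W where "W t = (\<integral>x. w (t - x) \<partial>pos_measure H) + (\<integral>x. w (t - x) \<partial>neg_measure H)" for t
  show ?thesis
  proof (rule loc_bvI)
    show "W t = 0" if "t \<le> a + d - 1" for t
    proof -
      have "\<forall>\<^sub>F x in ae_both H. w (t - x) = 0"
        using supp by eventually_elim (use w(4) that in auto)
      then have "(\<integral>x. w (t - x) \<partial>pos_measure H) = (\<integral>x. 0 \<partial>pos_measure H)" "(\<integral>x. w (t - x) \<partial>neg_measure H) = (\<integral>x. 0 \<partial>neg_measure H)"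
        using loc_bv_reflect_measurable[OF w(2), of t]
        by (intro integral_cong_AE; simp add: eventually_ae_both)+
      then show ?thesis by (simp add: W_def)
    qed
    fix s t :: real assume "s \<le> t"
    have *: "\<bar>(\<integral>x. F (t - x) \<partial>M) - (\<integral>x. F (s - x) \<partial>M)\<bar> \<le> (\<integral>x. w (t - x) \<partial>M) - (\<integral>x. w (s - x) \<partial>M)"
      if "integrable M (\<lambda>x. F (t - x))" "integrable M (\<lambda>x. F (s - x))"
         "integrable M (\<lambda>x. w (t - x))" "integrable M (\<lambda>x. w (s - x))" for M
    proof -
      have "\<bar>(\<integral>x. F (t - x) \<partial>M) - (\<integral>x. F (s - x) \<partial>M)\<bar> = \<bar>\<integral>x. F (t - x) - F (s - x) \<partial>M\<bar>"
        using that by simp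
      also have "\<dots> \<le> (\<integral>x. \<bar>F (t - x) - F (s - x)\<bar> \<partial>M)" by (rule integral_abs_bound)
      also have "\<dots> \<le> (\<integral>x. w (t - x) - w (s - x) \<partial>M)"
        using that \<open>s \<le> t\<close> by (intro integral_mono) (auto intro!: maj)
      finally show ?thesis using that by simp
    qed
    have "\<bar>conv F H t - conv F H s\<bar> \<le>
      \<bar>(\<integral>x. F (t - x) \<partial>pos_measure H) - (\<integral>x. F (s - x) \<partial>pos_measure H)\<bar> + \<bar>(\<integral>x. F (t - x) \<partial>neg_measure H) - (\<integral>x. F (s - x) \<partial>neg_measure H)\<bar>"
      by (simp add: conv_def signed_int_def)
    also have "\<dots> \<le> W t - W s"
      using *[of "pos_measure H"] *[of "neg_measure H"] intF[of t] intF[of s] intw[of t] intw[of s] by (simp add: abs_integrable_def W_def)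
    finally show "\<bar>conv F H t - conv F H s\<bar> \<le> W t - W s" .
  qed
qed

lemma conv_tendsto:
  assumes F: "loc_bv F" "vanishes_left F" and H: "loc_bv H"
    and T: "\<And>n. X n \<le> T" and lim: "\<And>x. (\<lambda>n. F (X n - x)) \<longlonglongrightarrow> F (t - x)"
  shows "(\<lambda>n. conv F H (X n)) \<longlonglongrightarrow> conv F H t"
proof -
  obtain w d where w: "mono w" "loc_bv w" "\<And>x y. x \<le> y \<Longrightarrow> \<bar>F y - F x\<bar> \<le> w y - w x"
    "\<And>x. x < d \<Longrightarrow> w x = 0" "\<And>x. \<bar>F x\<bar> \<le> w x" "\<And>x. 0 \<le> w x"
    by (rule loc_bv_majorant[OF F]) (rule that)
  have wl: "vanishes_left w" using w(4) by (rule vanishes_leftI)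
  have "\<bar>F (X n - x)\<bar> \<le> w (T - x)" for n x
    using w(5)[of "X n - x"] monoD[OF w(1), of "X n - x" "T - x"] T[of n] by linarith
  then show ?thesis
    unfolding conv_def
    by (intro signed_int_tendsto[where w = "\<lambda>x. w (T - x)"] abs_integrable_reflect[OF w(2) wl H] loc_bv_reflect_measurable F)
       (auto intro: always_eventually lim)
qed

lemma conv_right_cont:
  assumes F: "loc_bv F" "vanishes_left F" and rc: "\<And>x. continuous (at_right x) F" and H: "loc_bv H"
  shows "continuous (at_right t) (conv F H)"
proof -
  have "(conv F H \<longlongrightarrow> conv F H t) (at_right t)"
  proof (rule tendsto_at_right_sequentially[of t "t + 1"])
    fix S assume S: "\<And>n. t < S n" "\<And>n. S n < t + 1" "S \<longlonglongrightarrow> t"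
    show "(\<lambda>n. conv F H (S n)) \<longlonglongrightarrow> conv F H t"
    proof (rule conv_tendsto[OF F H])
      show "S n \<le> t + 1" for n using S(2)[of n] by simp
      show "(\<lambda>n. F (S n - x)) \<longlonglongrightarrow> F (t - x)" for x
      proof -
        have "filterlim (\<lambda>n. S n - x) (at_right (t - x)) sequentially"
          unfolding filterlim_at using S(1,3) by (auto intro!: always_eventually tendsto_diff)
        with rc[of "t - x"] show ?thesis
          unfolding continuous_within by (rule filterlim_compose)
      qed
    qed
  qed simp
  then show ?thesis by (simp add: continuous_within)
qed

text \<open>
  Subtracting their limits at \<open>-\<infinity>\<close> turns \<open>F(\<cdot>+)\<close> and \<open>H(\<cdot>+)\<close> into differences of distribution functions of
  measures, and each of the four products commutes by Fubini.
\<close>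

lemma conv_commute:
  assumes F: "loc_bv F" "\<And>x. x < c \<Longrightarrow> right_lim F x = k" and H: "loc_bv H" "\<And>x. x < d \<Longrightarrow> right_lim H x = l"
  shows "conv (\<lambda>x. right_lim F x - k) H t = conv (\<lambda>x. right_lim H x - l) F t"
proof -
  let ?P = "\<lambda>F x. measure (pos_measure F) {..x}" and ?N = "\<lambda>F x. measure (neg_measure F) {..x}"
  have dec: "right_lim F x - k = ?P F x - ?N F x" for x
    using measure_pos_neg_Iic[OF F, where c=c and x=x] by simp
  have dec': "right_lim H x - l = ?P H x - ?N H x" for x
    using measure_pos_neg_Iic[OF H, where c=d and x=x] by simp
  have a: "abs_integrable G (\<lambda>x. measure M {..t - x})" if G: "loc_bv G" and M: "lower_finite M" for G M
  proof -
    have s: "sets M = sets borel" using M by (simp add: lower_finite_def)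
    obtain c' where c': "emeasure M {..<c'} = 0" using M by (auto simp: lower_finite_def)
    have z: "measure M {..x} = 0" if "x \<le> c' - 1" for x
    proof -
      have "emeasure M {..x} \<le> emeasure M {..<c'}" using that by (intro emeasure_mono) (auto simp: s)
      with c' show ?thesis by (simp add: measure_def)
    qed
    show ?thesis
      by (rule abs_integrable_reflect[of "\<lambda>x. measure M {..x}"])
         (auto intro!: loc_bv_mono[of _ "c' - 1" 0] vanishes_leftI[of "c' - 1"] lower_finite_Iic_measurable(1) M z G)
  qed
  note fin = lower_finite_pos_measure[OF F(1)] lower_finite_neg_measure[OF F(1)] lower_finite_pos_measure[OF H(1)] lower_finite_neg_measure[OF H(1)]
  have "conv (\<lambda>x. right_lim F x - k) H t =
     (\<integral>x. ?P F (t - x) \<partial>pos_measure H) - (\<integral>x. ?N F (t - x) \<partial>pos_measure H) - ((\<integral>x. ?P F (t - x) \<partial>neg_measure H) - (\<integral>x. ?N F (t - x) \<partial>neg_measure H))"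
    unfolding conv_def dec using a[OF H(1) fin(1)] a[OF H(1) fin(2)] by (simp add: signed_int_def abs_integrable_def)
  also have "\<dots> = (\<integral>x. ?P H (t - x) \<partial>pos_measure F) - (\<integral>x. ?N H (t - x) \<partial>pos_measure F) - ((\<integral>x. ?P H (t - x) \<partial>neg_measure F) - (\<integral>x. ?N H (t - x) \<partial>neg_measure F))"
    using measure_convolution_commute[OF fin(1) fin(3), of t] measure_convolution_commute[OF fin(1) fin(4), of t]
      measure_convolution_commute[OF fin(2) fin(3), of t] measure_convolution_commute[OF fin(2) fin(4), of t] by simp
  also have "\<dots> = conv (\<lambda>x. right_lim H x - l) F t"
    unfolding conv_def dec' using a[OF F(1) fin(3)] a[OF F(1) fin(4)] by (simp add: signed_int_def abs_integrable_def)
  finally show ?thesis .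
qed

section \<open>The dual pair and its point evaluations\<close>

lemma right_lim_shift:
  assumes "loc_bv G"
  shows "right_lim (\<lambda>y. G (t + y)) x = right_lim G (t + x)"
proof (rule right_lim_eqI)
  have "((\<lambda>h. G (h + (t + x))) \<longlongrightarrow> right_lim G (t + x)) (at_right 0)"
    using right_lim_tendsto[OF assms, of "t + x"] filterlim_at_right_to_0[of G _ "t + x"] by simp
  then show "((\<lambda>y. G (t + y)) \<longlongrightarrow> right_lim G (t + x)) (at_right x)"
    unfolding filterlim_at_right_to_0[of "\<lambda>y. G (t + y)" _ x] by (simp add: ac_simps)
qed

lemma Y_loc_bv: "\<psi> \<in> Y \<Longrightarrow> loc_bv \<psi>"
  unfolding Y_def by (erule NBV_loc_bv) simp

lemma Y_const:
  assumes "\<psi> \<in> Y"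
  shows Y_above: "0 \<le> x \<Longrightarrow> \<psi> x = 0" and Y_below: "x \<le> -1 \<Longrightarrow> \<psi> x = \<psi> (-1)"
proof -
  have "\<psi> 0 = 0" using assms unfolding Y_def NBV_def mem_Collect_eq by (elim conjE)
  moreover have c: "(\<forall>x\<le>-1. \<psi> x = \<psi> (-1)) \<and> (\<forall>x\<ge>0. \<psi> x = \<psi> 0)"
    by (rule assms[unfolded Y_def NBV_def mem_Collect_eq, THEN conjunct2, THEN conjunct2, THEN conjunct2])
  ultimately show "0 \<le> x \<Longrightarrow> \<psi> x = 0" by metis
  show "x \<le> -1 \<Longrightarrow> \<psi> x = \<psi> (-1)" using c by blast
qed

lemma Y_right_lim:
  assumes "\<psi> \<in> Y"
  shows "-1 < x \<Longrightarrow> right_lim \<psi> x = \<psi> x" "x < -1 \<Longrightarrow> right_lim \<psi> x = \<psi> (-1)"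
proof -
  show "right_lim \<psi> x = \<psi> x" if "-1 < x"
  proof (cases "x < 0")
    case True
    with that assms have "continuous (at_right x) \<psi>" by (simp add: Y_def NBV_def)
    then show ?thesis by (rule right_lim_eq)
  next
    case False
    then show ?thesis using right_lim_above[of 0 \<psi> 0 x] Y_above[OF assms] by simp
  qed
  show "right_lim \<psi> x = \<psi> (-1)" if "x < -1"
    by (rule right_lim_below[OF Y_below[OF assms] that])
qed

lemma Y_support: "\<psi> \<in> Y \<Longrightarrow> \<forall>\<^sub>F x in ae_both \<psi>. -1 \<le> x"
  by (rule null_below[OF Y_loc_bv]) (auto intro: Y_right_lim(2))

text \<open>
  Pairing with \<open>probe \<theta>\<close> is evaluation at \<open>\<theta>\<close> up to sign. For \<open>\<theta> > -1\<close> the test function picks the mass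
  of \<open>(\<theta>, 0]\<close>. At \<open>\<theta> = -1\<close> the endpoint must be included, since an element of \<open>Y\<close> may have an atom at \<open>-1\<close>.
\<close>

definition probe :: "real \<Rightarrow> real \<Rightarrow> real" where
  "probe \<theta> = (if \<theta> = -1 then indicator {0..1} else indicator {0..<-\<theta>})"

lemma probe_Yd: "\<theta> \<in> {-1..0} \<Longrightarrow> probe \<theta> \<in> Yd"
  by (auto simp: Yd_def probe_def bounded_iff indicator_def intro!: exI[of _ 1])

lemma pairing_probe:
  assumes z: "z \<in> Y" and \<theta>: "\<theta> \<in> {-1..0}"
  shows "pairing (probe \<theta>) z = - z \<theta>"
proof -
  note F = Y_loc_bv[OF z]
  note supp = Y_support[OF z]
  have z0: "right_lim z 0 = 0" using Y_right_lim(1)[OF z, of 0] Y_above[OF z, of 0] by simp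
  show ?thesis
  proof (cases "\<theta> = -1")
    case True
    have "pairing (probe \<theta>) z = signed_int z (indicator {..0})"
      unfolding pairing_def stieltjes_eq_signed_int
    proof (rule signed_int_cong)
      show "\<forall>\<^sub>F x in ae_both z. indicator {-1..0} x * probe \<theta> (- x) = indicator {..0} x"
        using supp by eventually_elim (auto simp: probe_def True indicator_def)
    qed (auto simp: probe_def)
    also have "\<dots> = - z \<theta>"
      using signed_int_Iic[OF F Y_right_lim(2)[OF z], where c="-1" and b=0] z0 True by simp
    finally show ?thesis .
  next
    case False
    with \<theta> have \<theta>': "-1 < \<theta>" "\<theta> \<le> 0" by auto
    have "pairing (probe \<theta>) z = signed_int z (indicator {\<theta><..0})"
      unfolding pairing_def stieltjes_eq_signed_int
    proof (rule signed_int_cong)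
      show "\<forall>\<^sub>F x in ae_both z. indicator {-1..0} x * probe \<theta> (- x) = indicator {\<theta><..0} x"
        using \<theta>' by (intro always_eventually) (auto simp: probe_def False indicator_def)
    qed (auto simp: probe_def)
    also have "\<dots> = - z \<theta>"
      using signed_int_Ioc[OF F \<theta>'(2)] z0 Y_right_lim(1)[OF z \<theta>'(1)] by simp
    finally show ?thesis .
  qed
qed

lemma Y_eqI:
  assumes z: "z \<in> Y" "z' \<in> Y" and e: "\<And>\<theta>. \<theta> \<in> {-1..0} \<Longrightarrow> z \<theta> = z' \<theta>"
  shows "z = z'"
proof
  fix x :: real
  consider "x < -1" | "x \<in> {-1..0}" | "0 < x" by fastforce
  then show "z x = z' x"
  proof cases
    case 1
    then show ?thesis using Y_below[OF z(1), of x] Y_below[OF z(2), of x] e[of "-1"] by simp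
  next
    case 3
    then show ?thesis using Y_above[OF z(1), of x] Y_above[OF z(2), of x] by simp
  qed (rule e)
qed

text \<open>
  The test functions \<open>probe \<theta>\<close> separate the points of \<open>Y\<close>, so the description that defines \<open>act\<close> is unique.
\<close>

lemma act_twin_operator:
  assumes T: "twin_operator T" and y: "y \<in> Y"
  shows act_Y: "act T y \<in> Y" and pairing_act: "yd \<in> Yd \<Longrightarrow> pairing yd (act T y) = T yd y"
proof -
  obtain F where F: "F \<in> Y \<rightarrow> Y" "\<forall>yd\<in>Yd. \<forall>y\<in>Y. pairing yd (F y) = T yd y"
    using T unfolding twin_operator_def by blast
  have "act T y \<in> Y \<and> (\<forall>yd\<in>Yd. pairing yd (act T y) = T yd y)"
    unfolding act_def
  proof (rule theI[where P = "\<lambda>z. z \<in> Y \<and> (\<forall>yd\<in>Yd. pairing yd z = T yd y)"])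
    show "F y \<in> Y \<and> (\<forall>yd\<in>Yd. pairing yd (F y) = T yd y)" using F y by auto
    fix z assume z: "z \<in> Y \<and> (\<forall>yd\<in>Yd. pairing yd z = T yd y)"
    have Fy: "F y \<in> Y" using F y by auto
    show "z = F y"
    proof (rule Y_eqI)
      fix \<theta> :: real assume \<theta>: "\<theta> \<in> {-1..0}"
      have "- z \<theta> = - F y \<theta>"
        using pairing_probe[OF _ \<theta>, of z] pairing_probe[OF Fy \<theta>] z F(2) y probe_Yd[OF \<theta>] by simp
      then show "z \<theta> = F y \<theta>" by simp
    qed (use z Fy in auto)
  qed
  then show "act T y \<in> Y" "yd \<in> Yd \<Longrightarrow> pairing yd (act T y) = T yd y" by auto
qed

lemma act_eq_probe:
  assumes "twin_operator T" "y \<in> Y" "\<theta> \<in> {-1..0}"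
  shows "act T y \<theta> = - T (probe \<theta>) y"
  using pairing_probe[OF act_Y[OF assms(1,2)] assms(3)] pairing_act[OF assms(1,2) probe_Yd[OF assms(3)]]
  by simp

lemma q_loc_bv: "loc_bv q"
proof (rule loc_bv_mono)
  show "mono q" by (auto simp: mono_def q_def)
  show "q x = -1" if "x \<le> -1" for x using that by (simp add: q_def)
qed

lemma q_right_lim: "right_lim q = q"
proof
  fix x :: real show "right_lim q x = q x"
    using right_lim_above[of 0 q 0 x] right_lim_cong[of x 0 q "\<lambda>_. -1"] right_lim_above[of x "\<lambda>_. -1" "-1" x]
    by (cases "x < 0") (auto simp: q_def)
qed

lemma q_Y: "q \<in> Y"
proof -
  have "variation q {-1..0} \<le> ennreal (0 - (-1))"
    by (rule variation_upper_bound[where w=q]) (auto simp: q_def)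
  then have "bounded_variation_on q {-1..0}"
    unfolding bounded_variation_on_def by (rule le_less_trans) simp
  moreover have "continuous (at_right x) q" for x
    using right_lim_right_cont[OF q_loc_bv, of x] by (simp add: q_right_lim)
  ultimately show ?thesis by (simp add: Y_def NBV_def) (simp add: q_def)
qed

text \<open>
  Normalized at \<open>-\<infinity>\<close> instead of at \<open>0\<close>, an element of \<open>Y\<close> becomes the distribution function of its
  measure and can enter a convolution.
\<close>

definition centred :: "(real \<Rightarrow> real) \<Rightarrow> real \<Rightarrow> real" where
  "centred \<psi> x = right_lim \<psi> x - \<psi> (-1)"

lemma centred_facts:
  assumes "\<psi> \<in> Y"
  shows centred_loc_bv: "loc_bv (centred \<psi>)" and centred_vanishes_left: "vanishes_left (centred \<psi>)"
    and centred_right_cont: "continuous (at_right x) (centred \<psi>)"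
proof -
  show "loc_bv (centred \<psi>)"
    unfolding centred_def by (intro loc_bv_diff loc_bv_right_lim Y_loc_bv assms loc_bv_const)
  show "vanishes_left (centred \<psi>)"
    using Y_right_lim(2)[OF assms] by (intro vanishes_leftI[of "-1"]) (simp add: centred_def)
  show "continuous (at_right x) (centred \<psi>)"
    unfolding centred_def by (intro continuous_intros right_lim_right_cont Y_loc_bv assms)
qed

text \<open>
  For \<open>t \<ge> 0\<close> and \<open>\<psi> \<in> Y\<close> this is \<open>S\<^sub>0(t)\<psi>\<close> as a function on the real line; the maximum encodes the constant extension to
  the left of \<open>-1\<close>.
\<close>

definition shift :: "real \<Rightarrow> (real \<Rightarrow> real) \<Rightarrow> real \<Rightarrow> real" where
  "shift t \<psi> \<theta> = \<psi> (t + max \<theta> (-1))"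


section \<open>The kernel and its resolvent\<close>

locale kernel =
  fixes L :: "real \<Rightarrow> real"
  assumes L_NBV: "L \<in> NBV 0 1" and L_cont: "isCont L 0"
begin

lemma L_loc_bv: "loc_bv L"
  using NBV_loc_bv[OF L_NBV] by simp

lemma L_below: "x \<le> 0 \<Longrightarrow> L x = 0" and L_above: "1 \<le> x \<Longrightarrow> L x = L 1"
proof -
  have "L 0 = 0" using L_NBV unfolding NBV_def mem_Collect_eq by (elim conjE)
  moreover have c: "(\<forall>x\<le>0. L x = L 0) \<and> (\<forall>x\<ge>1. L x = L 1)"
    by (rule L_NBV[unfolded NBV_def mem_Collect_eq, THEN conjunct2, THEN conjunct2, THEN conjunct2])
  ultimately show "x \<le> 0 \<Longrightarrow> L x = 0" by metis
  show "1 \<le> x \<Longrightarrow> L x = L 1" using c by blast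
qed

lemma L_vanishes_left: "vanishes_left L"
  by (rule vanishes_leftI[of 0]) (simp add: L_below)

lemma L_right_lim: "right_lim L = L"
proof
  fix x :: real
  consider "x < 0" | "x = 0" | "0 < x" "x < 1" | "1 \<le> x" by linarith
  then show "right_lim L x = L x"
  proof cases
    case 1
    then show ?thesis using right_lim_below[of 0 L 0 x] L_below by simp
  next
    case 2
    have "continuous (at_right 0) L" using L_cont by (rule continuous_at_imp_continuous_within)
    then show ?thesis using 2 by (simp add: right_lim_eq)
  next
    case 3
    with L_NBV have "continuous (at_right x) L" by (simp add: NBV_def)
    then show ?thesis by (rule right_lim_eq)
  next
    case 4
    have "right_lim L x = L 1" by (rule right_lim_above[OF L_above 4])
    then show ?thesis using L_above[OF 4] by simp
  qed
qed

lemma L_right_cont: "continuous (at_right x) L"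
  using right_lim_right_cont[OF L_loc_bv, of x] by (simp add: L_right_lim)

lemma L_support: "\<forall>\<^sub>F x in ae_both L. 0 < x \<and> x \<le> 1"
proof (rule eventually_conj)
  show "\<forall>\<^sub>F x in ae_both L. 0 < x"
    by (rule null_below_le[OF L_loc_bv, of 0 0]) (simp add: L_right_lim L_below)
  show "\<forall>\<^sub>F x in ae_both L. x \<le> 1"
    by (rule null_above[OF L_loc_bv, of 1 "L 1"]) (simp only: L_right_lim, rule L_above)
qed

lemma signed_int_L_Iic: "signed_int L (indicator {..b}) = L b"
  using signed_int_Iic[OF L_loc_bv, of 0 0 b] by (simp add: L_right_lim L_below)

text \<open>
  Integrals over \<open>[0, 1]\<close> of a function that does not vanish on the left reduce to a convolution, since the
  constant \<open>k\<close> is integrated against the total mass \<open>L 1\<close>.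
\<close>

lemma L_integral_unit_interval:
  assumes F: "loc_bv F" "\<And>x. x < c \<Longrightarrow> F x = k"
  shows "signed_int L (\<lambda>x. indicator {0..1} x * F (t - x)) = conv (\<lambda>x. F x - k) L t + k * L 1"
proof -
  have F': "loc_bv (\<lambda>x. F x - k)" by (intro loc_bv_diff F loc_bv_const)
  have "signed_int L (\<lambda>x. indicator {0..1} x * F (t - x)) = signed_int L (\<lambda>x. (F (t - x) - k) + k * indicator {..1} x)"
  proof (rule signed_int_cong)
    show "\<forall>\<^sub>F x in ae_both L. indicator {0..1} x * F (t - x) = (F (t - x) - k) + k * indicator {..1} x"
      using L_support by eventually_elim (auto simp: indicator_def)
  qed (use loc_bv_reflect_measurable[OF F(1), of t] in \<open>auto\<close>)
  also have "\<dots> = signed_int L (\<lambda>x. F (t - x) - k) + k * L 1"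
    using abs_integrable_reflect[OF F' vanishes_leftI[of c] L_loc_bv, of t] F(2)
    by (subst signed_int_add) (auto intro!: abs_integrable_cmult abs_integrable_Iic L_loc_bv simp: signed_int_cmult signed_int_L_Iic L_loc_bv)
  finally show ?thesis by (simp add: conv_def)
qed

lemma Qd_Yd: "Qd L \<in> Yd"
proof -
  have "Qd L \<in> borel_measurable borel"
    using loc_bv_measurable[OF L_loc_bv] unfolding Qd_def[abs_def] by measurable
  moreover obtain w d where w: "mono w" "loc_bv w" "\<And>x y. x \<le> y \<Longrightarrow> \<bar>L y - L x\<bar> \<le> w y - w x"
    "\<And>x. x < d \<Longrightarrow> w x = 0" "\<And>x. \<bar>L x\<bar> \<le> w x" "\<And>x. 0 \<le> w x"
    by (rule loc_bv_majorant[OF L_loc_bv L_vanishes_left]) (rule that)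
  have "\<bar>Qd L a\<bar> \<le> w 1 + w 1" for a
    using w(5)[of a] w(5)[of 1] w(6)[of 1] monoD[OF w(1), of a 1] by (auto simp: Qd_def)
  then have "bounded (range (Qd L))" by (auto simp: bounded_iff)
  ultimately show ?thesis by (auto simp: Yd_def Qd_def)
qed

text \<open>
  Integration by parts for \<open>\<integral> (L(-\<theta>) - L(1)) z(d\<theta>)\<close>. The right limit matters at \<open>x = 1\<close> only: as
  \<open>Q\<^sup>\<diamond>(1) = 0\<close>, the pairing ignores the atom of \<open>z\<close> at \<open>-1\<close> and cannot see \<open>z(-1)\<close> itself.
\<close>

lemma pairing_Qd:
  assumes z: "z \<in> Y"
  shows "pairing (Qd L) z = signed_int L (\<lambda>x. indicator {0..1} x * right_lim z (0 - x))"
proof -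
  note F = Y_loc_bv[OF z]
  have "pairing (Qd L) z = signed_int z (\<lambda>\<theta>. L (0 - \<theta>) - L 1 * indicator {..0} \<theta>)"
    unfolding pairing_def stieltjes_eq_signed_int
  proof (rule signed_int_cong)
    show "\<forall>\<^sub>F \<theta> in ae_both z. indicator {-1..0} \<theta> * Qd L (- \<theta>) = L (0 - \<theta>) - L 1 * indicator {..0} \<theta>"
      using Y_support[OF z]
      by eventually_elim (auto simp: Qd_def indicator_def L_below)
    show "(\<lambda>\<theta>. indicator {-1..0} \<theta> * Qd L (- \<theta>)) \<in> borel_measurable borel"
      using Qd_Yd by (auto simp: Yd_def)
  qed (use loc_bv_reflect_measurable[OF L_loc_bv, of 0] in auto)
  also have "\<dots> = conv L z 0 - L 1 * signed_int z (indicator {..0})"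
    unfolding conv_def
    using abs_integrable_reflect[OF L_loc_bv L_vanishes_left F, of 0]
    by (subst signed_int_diff) (auto intro!: abs_integrable_cmult abs_integrable_Iic F simp: signed_int_cmult)
  also have "signed_int z (indicator {..0}) = - z (-1)"
    using signed_int_Iic[OF F Y_right_lim(2)[OF z], where c="-1" and b=0]
      Y_right_lim(1)[OF z, of 0] Y_above[OF z, of 0] by simp
  also have "conv L z 0 = conv (\<lambda>x. right_lim z x - z (-1)) L 0"
    using conv_commute[OF L_loc_bv, of 0 0 z "-1" "z (-1)" 0] F Y_right_lim(2)[OF z]
    by (simp add: L_right_lim L_below)
  finally show ?thesis
    using L_integral_unit_interval[OF loc_bv_right_lim[OF F] Y_right_lim(2)[OF z], of "-1" 0] by simp
qed

end

text \<open>
  For \<open>t \<ge> 0\<close> this is \<open>\<integral> L(da) (\<psi>((t - a)+) - \<psi>((-a)+))\<close>, the common value of \<open>V\<^sub>0(t)\<psi>\<close> and, if \<open>L\<close> has no atom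
  at \<open>1\<close>, of the forcing function. The maximum extends it by zero to negative \<open>t\<close>.
\<close>

definition increment :: "(real \<Rightarrow> real) \<Rightarrow> (real \<Rightarrow> real) \<Rightarrow> real \<Rightarrow> real" where
  "increment L \<psi> t = conv (centred \<psi>) L (max 0 t) - conv (centred \<psi>) L 0"

lemma increment_nonpos: "t \<le> 0 \<Longrightarrow> increment L \<psi> t = 0"
  by (simp add: increment_def max_absorb1)

lemma right_cont_max:
  fixes F :: "real \<Rightarrow> real"
  assumes "\<And>x. continuous (at_right x) F"
  shows "continuous (at_right x) (\<lambda>t. F (max 0 t))"
proof -
  have "((\<lambda>t. F (max 0 t)) \<longlongrightarrow> F (max 0 x)) (at_right x)"
  proof (cases "x < 0")
    case True
    have "\<forall>\<^sub>F t in at_right x. F (max 0 t) = F (max 0 x)"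
      using eventually_at_right_real[OF True] by eventually_elim (use True in auto)
    then show ?thesis by (rule tendsto_eventually)
  next
    case False
    have "(F \<longlongrightarrow> F x) (at_right x)" using assms[of x] by (simp add: continuous_within)
    moreover have "\<forall>\<^sub>F t in at_right x. F t = F (max 0 t)"
      using eventually_at_right_less[of x] by eventually_elim (use False in auto)
    ultimately have "((\<lambda>t. F (max 0 t)) \<longlongrightarrow> F x) (at_right x)" by (rule Lim_transform_eventually)
    then show ?thesis using False by simp
  qed
  then show ?thesis by (simp add: continuous_within)
qed

context kernel
begin

lemma increment_facts:
  assumes "\<psi> \<in> Y"
  shows increment_loc_bv: "loc_bv (increment L \<psi>)"
    and increment_vanishes_left: "vanishes_left (increment L \<psi>)"
    and increment_right_cont: "continuous (at_right x) (increment L \<psi>)"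
proof -
  note c = centred_loc_bv[OF assms] centred_vanishes_left[OF assms]
  show "loc_bv (increment L \<psi>)"
    unfolding increment_def by (intro loc_bv_diff loc_bv_const loc_bv_max conv_loc_bv c L_loc_bv)
  show "vanishes_left (increment L \<psi>)"
    by (rule vanishes_leftI[of 0]) (simp add: increment_nonpos)
  show "continuous (at_right x) (increment L \<psi>)"
    unfolding increment_def
    by (intro continuous_intros right_cont_max conv_right_cont c centred_right_cont assms L_loc_bv)
qed

lemma pairing_Qd_shift:
  assumes \<psi>: "\<psi> \<in> Y" and s: "shift t \<psi> \<in> Y"
  shows "pairing (Qd L) (shift t \<psi>) = conv (centred \<psi>) L t + \<psi> (-1) * L 1"
proof -
  note F = Y_loc_bv[OF \<psi>]
  have r: "right_lim (shift t \<psi>) (0 - x) = right_lim \<psi> (t - x)" if "x \<le> 1" for x :: real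
  proof -
    have "right_lim (shift t \<psi>) (-x) = right_lim (\<lambda>y. \<psi> (t + y)) (-x)"
      using that by (intro right_lim_cong[of "-x" "-x + 1"]) (auto simp: shift_def)
    also have "\<dots> = right_lim \<psi> (t - x)" by (simp add: right_lim_shift[OF F])
    finally show ?thesis by simp
  qed
  have "pairing (Qd L) (shift t \<psi>) = signed_int L (\<lambda>x. indicator {0..1} x * right_lim (shift t \<psi>) (0 - x))"
    by (rule pairing_Qd[OF s])
  also have "(\<lambda>x. indicator {0..1} x * right_lim (shift t \<psi>) (0 - x)) = (\<lambda>x. indicator {0..1} x * right_lim \<psi> (t - x))"
    using r by (auto simp: fun_eq_iff indicator_def)
  also have "signed_int L \<dots> = conv (\<lambda>x. right_lim \<psi> x - \<psi> (-1)) L t + \<psi> (-1) * L 1"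
    by (rule L_integral_unit_interval[OF loc_bv_right_lim[OF F] Y_right_lim(2)[OF \<psi>]])
  finally show ?thesis by (simp add: centred_def[abs_def])
qed

lemma shift_0: "\<psi> \<in> Y \<Longrightarrow> shift 0 \<psi> = \<psi>"
  unfolding shift_def fun_eq_iff
proof
  fix x assume "\<psi> \<in> Y"
  then show "\<psi> (0 + max x (-1)) = \<psi> x"
    using Y_below[of \<psi> x] by (cases "x \<le> -1") (simp_all add: max_def)
qed

text \<open>
  The centred \<open>q\<close> is the Heaviside function, the unit of convolution. This is why the kernel
  \<open>K\<close> of the perturbation is \<open>L\<close> itself.
\<close>

lemma increment_q: "increment L q = L"
proof
  fix t
  have "centred q = indicator {0..}"
    by (auto simp: fun_eq_iff centred_def q_right_lim q_def)
  then have c: "conv (centred q) L t = L t" for t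
  proof -
    have "(\<lambda>x. indicator {0..} (t - x) :: real) = indicator {..t}" by (auto simp: fun_eq_iff indicator_def)
    with \<open>centred q = indicator {0..}\<close> show ?thesis by (simp add: conv_def signed_int_L_Iic)
  qed
  show "increment L q t = L t"
    by (cases "t \<le> 0") (simp_all add: increment_def c L_below max_def)
qed

context
  fixes \<rho> assumes \<rho>: "is_resolvent L \<rho>"
begin

lemma resolvent_nonpos: "x \<le> 0 \<Longrightarrow> \<rho> x = 0"
  using \<rho> by (simp add: is_resolvent_def NBV_loc_def)

lemma resolvent_loc_bv: "loc_bv \<rho>"
  using \<rho> by (auto simp: is_resolvent_def intro: NBV_loc_loc_bv)

lemma resolvent_vanishes_left: "vanishes_left \<rho>"
  by (rule vanishes_leftI[of 0]) (simp add: resolvent_nonpos)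

lemma resolvent_support: "\<forall>\<^sub>F x in ae_both \<rho>. 0 \<le> x"
  by (rule null_below[OF resolvent_loc_bv, of 0 0]) (rule right_lim_below[OF resolvent_nonpos])

lemma stieltjes_resolvent:
  assumes F: "loc_bv F" "\<And>x. x \<le> 0 \<Longrightarrow> F x = 0"
  shows "stieltjes \<rho> {0..t} (\<lambda>x. F (t - x)) = conv F \<rho> t"
  unfolding stieltjes_eq_signed_int conv_def
proof (rule signed_int_cong)
  show "\<forall>\<^sub>F x in ae_both \<rho>. indicator {0..t} x * F (t - x) = F (t - x)"
    using resolvent_support by eventually_elim (auto simp: indicator_def F(2))
qed (use loc_bv_reflect_measurable[OF F(1), of t] in auto)

lemma resolvent_eq_conv_kernel: "\<rho> a = conv L \<rho> a + L a"
proof (cases "0 \<le> a")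
  case True
  then have "\<rho> a = stieltjes \<rho> {0..a} (\<lambda>\<sigma>. L (a - \<sigma>)) + L a"
    using \<rho> unfolding is_resolvent_def by blast
  then show ?thesis using stieltjes_resolvent[OF L_loc_bv L_below] by simp
next
  case False
  then have "conv L \<rho> a = 0" using conv_eq_0[OF resolvent_support L_loc_bv L_below, where c=0] by simp
  then show ?thesis using False by (simp add: resolvent_nonpos L_below)
qed

text \<open>
  Right-continuity at \<open>0\<close> is not part of the definition of the space of \<open>\<rho>\<close>; it follows from the
  resolvent equation, whose right-hand side is right-continuous.
\<close>

lemma resolvent_right_lim: "right_lim \<rho> = \<rho>"
proof
  fix x
  have "continuous (at_right x) (\<lambda>a. conv L \<rho> a + L a)"
    by (intro continuous_intros conv_right_cont L_loc_bv L_vanishes_left L_right_cont resolvent_loc_bv)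
  then have "continuous (at_right x) \<rho>"
    by (simp add: resolvent_eq_conv_kernel[symmetric])
  then show "right_lim \<rho> x = \<rho> x" by (rule right_lim_eq)
qed

lemma resolvent_eq_conv: "\<rho> a = conv \<rho> L a + L a"
  using conv_commute[OF L_loc_bv, of 0 0 \<rho> 0 0 a] resolvent_loc_bv resolvent_eq_conv_kernel[of a]
  by (simp add: L_right_lim resolvent_right_lim L_below resolvent_nonpos)

end

text \<open>
  Here the continuity of \<open>L\<close> at \<open>0\<close> enters: the measure of \<open>L\<close> has no atom at \<open>0\<close>.
\<close>

lemma kernel_mass_small: "\<exists>\<delta>>0. mass_upto L \<delta> \<le> 1/2"
proof -
  have mass_upto: "mass_upto L x = 2 * variation_fun L x - L x" for x
    using measure_pos_neg_Iic[OF L_loc_bv, of 0 0 x] by (simp add: mass_upto_def L_right_lim L_below)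
  have "variation_fun L 0 = 0" by (rule variation_fun_eq_0[of 0 L 0]) (simp add: L_right_lim L_below)
  then have 0: "mass_upto L 0 = 0" by (simp add: mass_upto L_below)
  have "continuous (at_right 0) (\<lambda>x. 2 * variation_fun L x - L x)"
    by (intro continuous_intros variation_fun_right_cont L_loc_bv L_right_cont)
  then have "(mass_upto L \<longlongrightarrow> 0) (at_right 0)"
    using 0 unfolding continuous_within mass_upto[symmetric] by simp
  then have "\<forall>\<^sub>F x in at_right 0. mass_upto L x < 1/2"
    by (rule order_tendstoD) simp
  then obtain b where "0 < b" "\<And>y. 0 < y \<Longrightarrow> y < b \<Longrightarrow> mass_upto L y < 1/2"
    by (auto simp: eventually_at_right_field)
  then show ?thesis by (intro exI[of _ "b/2"]) (auto intro: less_imp_le)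
qed

text \<open>
  On an interval of length \<open>\<delta>\<close> after the zeros of \<open>D\<close>, only the part of the measure of \<open>L\<close> on \<open>(0, \<delta>]\<close> contributes,
  which has total mass at most \<open>1/2\<close>. So each use of the equation halves the bound for \<open>D\<close>, hence \<open>D\<close> vanishes there too,
  and the zeros spread over the whole line in steps of length \<open>\<delta>\<close>.
\<close>

lemma conv_kernel_fixpoint_zero:
  assumes D: "loc_bv D" "\<And>x. x \<le> 0 \<Longrightarrow> D x = 0" and fix_pt: "\<And>a. D a = conv D L a"
  shows "D x = 0"
proof -
  obtain \<delta> where \<delta>: "0 < \<delta>" "mass_upto L \<delta> \<le> 1/2" using kernel_mass_small by blast
  have ln: "vanishes_left D" by (rule vanishes_leftI[of 0]) (simp add: D)
  obtain w d where w: "mono w" "loc_bv w" "\<And>x y. x \<le> y \<Longrightarrow> \<bar>D y - D x\<bar> \<le> w y - w x"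
    "\<And>x. x < d \<Longrightarrow> w x = 0" "\<And>x. \<bar>D x\<bar> \<le> w x" "\<And>x. 0 \<le> w x"
    by (rule loc_bv_majorant[OF D(1) ln]) (rule that)
  have step: "D x = 0" if c: "\<And>y. y \<le> c \<Longrightarrow> D y = 0" and "x \<le> c + \<delta>" for c x
  proof -
    have "\<bar>D y\<bar> \<le> w (c + \<delta>) / 2 ^ m" if "y \<le> c + \<delta>" for m y
      using that
    proof (induction m arbitrary: y)
      case 0
      then show ?case using w(5)[of y] monoD[OF w(1), of y "c + \<delta>"] by simp
    next
      case (Suc m)
      have "\<bar>signed_int L (\<lambda>x. D (y - x))\<bar> \<le> (w (c + \<delta>) / 2 ^ m) * mass_upto L \<delta>"
      proof (rule signed_int_bound[OF L_loc_bv loc_bv_reflect_measurable[OF D(1)]])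
        show "\<forall>\<^sub>F x in ae_both L. \<bar>D (y - x)\<bar> \<le> w (c + \<delta>) / 2 ^ m * indicator {..\<delta>} x"
          using L_support
        proof eventually_elim
          case (elim x)
          show ?case
          proof (cases "x \<le> \<delta>")
            case True
            then show ?thesis using Suc.IH[of "y - x"] Suc.prems elim by simp
          next
            case False
            then have "D (y - x) = 0" using Suc.prems by (intro c) linarith
            then show ?thesis using False by simp
          qed
        qed
      qed
      also have "\<dots> \<le> (w (c + \<delta>) / 2 ^ m) * (1/2)"
        using w(6)[of "c + \<delta>"] by (intro mult_left_mono \<delta>) auto
      finally show ?case using fix_pt[of y] by (simp add: conv_def field_simps)
    qed
    moreover have "(\<lambda>m. w (c + \<delta>) / 2 ^ m) \<longlonglongrightarrow> 0" by (rule LIMSEQ_divide_realpow_zero) simp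
    ultimately have "\<bar>D x\<bar> \<le> 0" using \<open>x \<le> c + \<delta>\<close> by (intro LIMSEQ_le_const) auto
    then show ?thesis by simp
  qed
  have "\<forall>x\<le>real n * \<delta>. D x = 0" for n
  proof (induction n)
    case 0
    then show ?case using D(2) by simp
  next
    case (Suc n)
    then show ?case using step[of "real n * \<delta>"] by (auto simp: algebra_simps)
  qed
  moreover obtain n where "x < real n * \<delta>" using ex_less_of_nat_mult[OF \<delta>(1)] by blast
  ultimately show ?thesis by (auto intro: less_imp_le)
qed

lemma resolvent_unique:
  assumes "is_resolvent L \<rho>" "is_resolvent L \<rho>'"
  shows "\<rho> = \<rho>'"
proof
  fix x
  note r = resolvent_loc_bv[OF assms(1)] resolvent_vanishes_left[OF assms(1)]
    and r' = resolvent_loc_bv[OF assms(2)] resolvent_vanishes_left[OF assms(2)]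
  have "\<rho> x - \<rho>' x = 0"
  proof (rule conv_kernel_fixpoint_zero[where D = "\<lambda>x. \<rho> x - \<rho>' x"])
    show "loc_bv (\<lambda>x. \<rho> x - \<rho>' x)" by (intro loc_bv_diff r r')
    show "\<rho> x - \<rho>' x = 0" if "x \<le> 0" for x
      using that resolvent_nonpos[OF assms(1)] resolvent_nonpos[OF assms(2)] by simp
    show "\<rho> a - \<rho>' a = conv (\<lambda>x. \<rho> x - \<rho>' x) L a" for a
      using resolvent_eq_conv[OF assms(1), of a] resolvent_eq_conv[OF assms(2), of a]
        abs_integrable_reflect[OF r L_loc_bv, of a] abs_integrable_reflect[OF r' L_loc_bv, of a]
      by (simp add: conv_def signed_int_diff)
  qed
  then show "\<rho> x = \<rho>' x" by simp
qed

text \<open>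
  The equation \<open>L = \<rho> - \<rho> * dL\<close> transfers left-continuity from \<open>\<rho>\<close> to \<open>L\<close>.
\<close>

lemma L_no_atom_if_resolvent_atomless:
  assumes \<rho>: "is_resolvent L \<rho>" and atom: "\<And>s. 0 < s \<Longrightarrow> signed_int \<rho> (indicator {s}) = 0"
  shows "signed_int L (indicator {1}) = 0"
proof -
  have left: "(\<lambda>n. \<rho> (s - 1 / real (Suc n))) \<longlonglongrightarrow> \<rho> s" for s
  proof (cases "0 < s")
    case True
    have "(\<lambda>n. \<rho> s - (\<rho> s - \<rho> (s - 1 / real (Suc n)))) \<longlonglongrightarrow> \<rho> s - 0"
      using jumps_tendsto_atom[OF resolvent_loc_bv[OF \<rho>], of s] atom[OF True]
      by (intro tendsto_diff tendsto_const) (simp add: resolvent_right_lim[OF \<rho>])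
    then show ?thesis by simp
  next
    case False
    have "\<rho> (s - 1 / real (Suc n)) = \<rho> s" for n
    proof -
      have "0 \<le> 1 / real (Suc n)" by simp
      with False have "s - 1 / real (Suc n) \<le> 0" "s \<le> 0" by linarith+
      then show ?thesis by (simp only: resolvent_nonpos[OF \<rho>])
    qed
    then show ?thesis by simp
  qed
  have "(\<lambda>n. conv \<rho> L (1 - 1 / real (Suc n))) \<longlonglongrightarrow> conv \<rho> L 1"
  proof (rule conv_tendsto[OF resolvent_loc_bv[OF \<rho>] resolvent_vanishes_left[OF \<rho>] L_loc_bv])
    show "1 - 1 / real (Suc n) \<le> 1" for n by simp
    show "(\<lambda>n. \<rho> (1 - 1 / real (Suc n) - x)) \<longlonglongrightarrow> \<rho> (1 - x)" for x
      using left[of "1 - x"] by (simp add: algebra_simps)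
  qed
  then have "(\<lambda>n. \<rho> (1 - 1 / real (Suc n)) - conv \<rho> L (1 - 1 / real (Suc n))) \<longlonglongrightarrow> \<rho> 1 - conv \<rho> L 1"
    by (intro tendsto_diff left)
  moreover have "\<rho> a - conv \<rho> L a = L a" for a using resolvent_eq_conv[OF \<rho>, of a] by simp
  ultimately have "(\<lambda>n. L (1 - 1 / real (Suc n))) \<longlonglongrightarrow> L 1" by simp
  then have "(\<lambda>n. L 1 - L (1 - 1 / real (Suc n))) \<longlonglongrightarrow> L 1 - L 1"
    by (intro tendsto_diff tendsto_const)
  moreover have "(\<lambda>n. L 1 - L (1 - 1 / real (Suc n))) \<longlonglongrightarrow> signed_int L (indicator {1})"
    using jumps_tendsto_atom[OF L_loc_bv, of 1] by (simp add: L_right_lim)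
  ultimately show ?thesis using LIMSEQ_unique by fastforce
qed

text \<open>
  The forcing function contains \<open>\<psi>\<close> where the increment contains its right limit. The two
  differ at \<open>-1\<close> only, which is reached for \<open>t = 0\<close> and \<open>a = 1\<close>; there the measure of \<open>L\<close> has no atom.
\<close>

lemma forcing_eq_increment:
  assumes \<psi>: "\<psi> \<in> Y" and atom: "signed_int L (indicator {1}) = 0" and "0 \<le> t"
  shows "forcing L \<psi> t = increment L \<psi> t"
proof -
  note F = Y_loc_bv[OF \<psi>]
  have int_c: "abs_integrable L (\<lambda>x. centred \<psi> (s - x))" for s
    by (rule abs_integrable_reflect[OF centred_loc_bv[OF \<psi>] centred_vanishes_left[OF \<psi>] L_loc_bv])
  have int_i: "abs_integrable L (\<lambda>x. k * indicator {..1} x)" for k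
    by (intro abs_integrable_cmult abs_integrable_Iic L_loc_bv)
  have int_1: "abs_integrable L (\<lambda>x. k * indicator {1} x)" for k
    by (intro abs_integrable_cmult abs_integrable_indicator[of L _ 1] L_loc_bv) auto
  have meas: "(\<lambda>x. \<psi> (s - x)) \<in> borel_measurable borel" for s
    by (rule loc_bv_reflect_measurable[OF F])
  have base: "stieltjes L {0..1} (\<lambda>a. \<psi> (- a)) = conv (centred \<psi>) L 0 + \<psi> (-1) * L 1"
  proof -
    have "stieltjes L {0..1} (\<lambda>a. \<psi> (- a)) = signed_int L (\<lambda>x. (centred \<psi> (0 - x) + \<psi> (-1) * indicator {..1} x)
        + (\<psi> (-1) - right_lim \<psi> (-1)) * indicator {1} x)"
      unfolding stieltjes_eq_signed_int
    proof (rule signed_int_cong)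
      show "\<forall>\<^sub>F x in ae_both L. indicator {0..1} x * \<psi> (- x) =
        centred \<psi> (0 - x) + \<psi> (-1) * indicator {..1} x + (\<psi> (-1) - right_lim \<psi> (-1)) * indicator {1} x"
        using L_support
      proof eventually_elim
        case (elim x)
        then show ?case using Y_right_lim(1)[OF \<psi>, of "-x"] by (cases "x = 1") (auto simp: centred_def)
      qed
    qed (use meas[of 0] abs_integrable_add[OF abs_integrable_add[OF int_c[of 0] int_i] int_1] in \<open>auto intro: abs_integrable_measurable\<close>)
    also have "\<dots> = conv (centred \<psi>) L 0 + \<psi> (-1) * L 1"
      unfolding signed_int_add[OF abs_integrable_add[OF int_c int_i] int_1] signed_int_add[OF int_c int_i] signed_int_cmult
      by (simp add: atom signed_int_L_Iic conv_def)
    finally show ?thesis .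
  qed
  show ?thesis
  proof (cases "t = 0")
    case True
    have "stieltjes L {0<..1} (\<lambda>a. \<psi> (0 - a)) = stieltjes L {0..1} (\<lambda>a. \<psi> (- a))"
      unfolding stieltjes_eq_signed_int
    proof (rule signed_int_cong)
      show "\<forall>\<^sub>F x in ae_both L. indicator {0<..1} x * \<psi> (0 - x) = indicator {0..1} x * \<psi> (- x)"
        using L_support by eventually_elim (auto simp: indicator_def)
    qed (use meas[of 0] in auto)
    then show ?thesis using True by (simp add: forcing_def increment_def)
  next
    case False
    with \<open>0 \<le> t\<close> have "0 < t" by simp
    have "stieltjes L {t<..1} (\<lambda>a. \<psi> (t - a)) = signed_int L (\<lambda>x. centred \<psi> (t - x) + \<psi> (-1) * indicator {..1} x)"
      unfolding stieltjes_eq_signed_int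
    proof (rule signed_int_cong)
      show "\<forall>\<^sub>F x in ae_both L. indicator {t<..1} x * \<psi> (t - x) = centred \<psi> (t - x) + \<psi> (-1) * indicator {..1} x"
        using L_support
      proof eventually_elim
        case (elim x)
        then show ?case using Y_right_lim(1)[OF \<psi>, of "t-x"] \<open>0 < t\<close> Y_above[OF \<psi>, of "t - x"]
          by (auto simp: centred_def indicator_def)
      qed
    qed (use meas[of t] abs_integrable_add[OF int_c[of t] int_i] in \<open>auto intro: abs_integrable_measurable\<close>)
    also have "\<dots> = conv (centred \<psi>) L t + \<psi> (-1) * L 1"
      unfolding signed_int_add[OF int_c int_i] signed_int_cmult by (simp add: signed_int_L_Iic conv_def)
    finally show ?thesis using base \<open>0 < t\<close> by (simp add: forcing_def increment_def)
  qed
qed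

end

section \<open>The perturbed semigroup solves the renewal equation\<close>

lemma twin_semigroup_facts:
  assumes "twin_semigroup S"
  shows twin_semigroup_twin_operator: "t \<ge> 0 \<Longrightarrow> twin_operator (S t)"
    and twin_semigroup_0: "yd \<in> Yd \<Longrightarrow> y \<in> Y \<Longrightarrow> S 0 yd y = pairing yd y"
    and twin_semigroup_add: "t \<ge> 0 \<Longrightarrow> s \<ge> 0 \<Longrightarrow> yd \<in> Yd \<Longrightarrow> y \<in> Y \<Longrightarrow> S (t + s) yd y = S t yd (act (S s) y)"
proof -
  obtain M \<omega> where "twin_semigroup_type S M \<omega>" using assms unfolding twin_semigroup_def by blast
  note type = this[unfolded twin_semigroup_type_def]
  show "t \<ge> 0 \<Longrightarrow> twin_operator (S t)" using type[THEN conjunct1] by blast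
  show "yd \<in> Yd \<Longrightarrow> y \<in> Y \<Longrightarrow> S 0 yd y = pairing yd y"
    using type[THEN conjunct2, THEN conjunct1] by blast
  show "t \<ge> 0 \<Longrightarrow> s \<ge> 0 \<Longrightarrow> yd \<in> Yd \<Longrightarrow> y \<in> Y \<Longrightarrow> S (t + s) yd y = S t yd (act (S s) y)"
    using type[THEN conjunct2, THEN conjunct2, THEN conjunct1] by blast
qed

locale renewal_semigroup = kernel L for L +
  fixes R RK :: "real \<Rightarrow> real" and S0 S :: "real \<Rightarrow> bilin"
  assumes R: "is_resolvent L R"
    and S0_twin: "twin_semigroup S0"
    and S0: "\<And>t \<psi> \<theta>. t \<ge> 0 \<Longrightarrow> \<psi> \<in> Y \<Longrightarrow> \<theta> \<in> {-1..0} \<Longrightarrow>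
               act (S0 t) \<psi> \<theta> = (if t + \<theta> \<le> 0 then \<psi> (t + \<theta>) else 0)"
    and RK: "is_resolvent (K L S0) RK"
    and S_twin: "twin_semigroup S"
    and S: "\<And>t yd \<psi>. t \<ge> 0 \<Longrightarrow> yd \<in> Yd \<Longrightarrow> \<psi> \<in> Y \<Longrightarrow>
               S t yd \<psi> = S0 t yd \<psi> + stieltjes (\<lambda>\<tau>. V L S0 RK \<tau> \<psi>) {0..t} (\<lambda>\<tau>. W0 S0 (t - \<tau>) yd)"
begin

lemmas S0_twin_operator = twin_semigroup_twin_operator[OF S0_twin]
  and S_twin_operator = twin_semigroup_twin_operator[OF S_twin]
  and S_add = twin_semigroup_add[OF S_twin]

text \<open>
  Membership in \<open>Y\<close> determines the values outside \<open>[-1, 0]\<close>, so the equality holds on the whole line.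
\<close>

lemma act_S0:
  assumes "t \<ge> 0" "\<psi> \<in> Y"
  shows "act (S0 t) \<psi> = shift t \<psi>"
proof
  fix x :: real
  note aY = act_Y[OF S0_twin_operator[OF assms(1)] assms(2)]
  have e: "act (S0 t) \<psi> \<theta> = \<psi> (t + \<theta>)" if "\<theta> \<in> {-1..0}" for \<theta>
    using S0[OF assms that] Y_above[OF assms(2), of "t + \<theta>"] by auto
  consider "x < -1" | "x \<in> {-1..0}" | "0 < x" by fastforce
  then show "act (S0 t) \<psi> x = shift t \<psi> x"
  proof cases
    case 1
    then show ?thesis using Y_below[OF aY, of x] e[of "-1"] by (simp add: shift_def)
  next
    case 2
    then show ?thesis using e[of x] by (simp add: shift_def)
  next
    case 3
    then show ?thesis using Y_above[OF aY, of x] Y_above[OF assms(2), of "t + x"] assms(1)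
      by (simp add: shift_def)
  qed
qed

lemma S0_eq_pairing:
  assumes "t \<ge> 0" "\<psi> \<in> Y"
  shows "shift t \<psi> \<in> Y" and "yd \<in> Yd \<Longrightarrow> S0 t yd \<psi> = pairing yd (shift t \<psi>)"
  using act_Y[OF S0_twin_operator[OF assms(1)] assms(2)] pairing_act[OF S0_twin_operator[OF assms(1)] assms(2)]
  by (simp_all add: act_S0[OF assms])

lemma V0_eq_increment:
  assumes "\<psi> \<in> Y"
  shows "V0 L S0 t \<psi> = increment L \<psi> t"
proof (cases "t < 0")
  case True
  then show ?thesis by (simp add: V0_def increment_nonpos)
next
  case False
  then have t: "0 \<le> t" by simp
  have "pairing (Qd L) \<psi> = conv (centred \<psi>) L 0 + \<psi> (-1) * L 1"
    using pairing_Qd_shift[OF assms, of 0] assms by (simp add: shift_0)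
  then show ?thesis
    using t pairing_Qd_shift[OF assms S0_eq_pairing(1)[OF t assms]] S0_eq_pairing(2)[OF t assms Qd_Yd]
    by (simp add: V0_def increment_def)
qed

lemma K_eq_L: "K L S0 = L"
  by (simp add: fun_eq_iff K_def V0_eq_increment[OF q_Y] increment_q)

lemma RK_resolvent: "is_resolvent L RK"
  using RK by (simp add: K_eq_L)

lemma RK_eq_R: "RK = R"
  by (rule resolvent_unique[OF RK_resolvent R])

lemma V_eq_conv:
  assumes "\<psi> \<in> Y"
  shows "V L S0 RK t \<psi> = increment L \<psi> t + conv (increment L \<psi>) RK t"
proof (cases "t < 0")
  case True
  then show ?thesis
    using conv_eq_0[OF resolvent_support[OF RK_resolvent] increment_loc_bv[OF assms] increment_nonpos, of 0 t]
    by (simp add: V_def increment_nonpos)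
next
  case False
  then show ?thesis
    using stieltjes_resolvent[OF RK_resolvent increment_loc_bv[OF assms] increment_nonpos, of t]
    by (simp add: V_def V0_eq_increment[OF assms])
qed

lemma V_facts:
  assumes "\<psi> \<in> Y"
  shows V_loc_bv: "loc_bv (\<lambda>t. V L S0 RK t \<psi>)"
    and V_right_lim: "right_lim (\<lambda>t. V L S0 RK t \<psi>) = (\<lambda>t. V L S0 RK t \<psi>)"
    and V_nonpos: "t \<le> 0 \<Longrightarrow> V L S0 RK t \<psi> = 0"
proof -
  note i = increment_loc_bv[OF assms] increment_vanishes_left[OF assms]
  note r = resolvent_loc_bv[OF RK_resolvent]
  show "loc_bv (\<lambda>t. V L S0 RK t \<psi>)"
    unfolding V_eq_conv[OF assms] by (intro loc_bv_add conv_loc_bv i r)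
  have "continuous (at_right t) (\<lambda>t. V L S0 RK t \<psi>)" for t
    unfolding V_eq_conv[OF assms]
    by (intro continuous_intros conv_right_cont i r increment_right_cont assms)
  then show "right_lim (\<lambda>t. V L S0 RK t \<psi>) = (\<lambda>t. V L S0 RK t \<psi>)"
    by (auto simp: fun_eq_iff right_lim_eq)
  show "t \<le> 0 \<Longrightarrow> V L S0 RK t \<psi> = 0"
    using conv_eq_0[OF resolvent_support[OF RK_resolvent] i(1) increment_nonpos, of 0 t]
    by (simp add: V_eq_conv[OF assms] increment_nonpos)
qed

lemma V_q: "(\<lambda>t. V L S0 RK t q) = RK"
  using resolvent_eq_conv_kernel[OF RK_resolvent]
  by (simp add: fun_eq_iff V_eq_conv[OF q_Y] increment_q)

abbreviation atom :: "(real \<Rightarrow> real) \<Rightarrow> real \<Rightarrow> real" where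
  "atom \<psi> s \<equiv> signed_int (\<lambda>t. V L S0 RK t \<psi>) (indicator {s})"

text \<open>
  The last two terms form the left limit of \<open>V(\<cdot>)\<psi>\<close> at \<open>t\<close>: because of \<open>W\<^sub>0(0) = 0\<close> the point \<open>\<tau> = t\<close> does not contribute to the
  integral against the measure of \<open>V(\<cdot>)\<psi>\<close>.
\<close>

lemma act_S_eq:
  assumes t: "0 < t" and \<psi>: "\<psi> \<in> Y" and \<theta>: "-1 \<le> \<theta>" "\<theta> < 0"
  shows "act (S t) \<psi> \<theta> = \<psi> (t + \<theta>) + V L S0 RK (max 0 (t + \<theta>)) \<psi> - (V L S0 RK t \<psi> - atom \<psi> t)"
proof -
  let ?V = "\<lambda>t. V L S0 RK t \<psi>"
  have \<theta>': "\<theta> \<in> {-1..0}" and t': "0 \<le> t" using \<theta> t by auto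
  define m where "m = max 0 (t + \<theta>)"
  have m: "m < t" using t \<theta> by (simp add: m_def)
  have probe: "S0 s (probe \<theta>) \<phi> = - \<phi> (s + \<theta>)" if "0 \<le> s" "\<phi> \<in> Y" for s \<phi>
    using S0_eq_pairing[OF that] pairing_probe[OF _ \<theta>', of "shift s \<phi>"] probe_Yd[OF \<theta>'] \<theta>
    by (simp add: shift_def)
  \<comment> \<open>the value \<open>0\<close> at \<open>s = 0\<close> comes from the convention \<open>W\<^sub>0(0) = 0\<close>\<close>
  have W: "W0 S0 s (probe \<theta>) = (if 0 < s \<and> s + \<theta> < 0 then 1 else 0)" for s
    using probe[of s q] q_Y by (auto simp: W0_def q_def)
  have "stieltjes ?V {0..t} (\<lambda>\<tau>. W0 S0 (t - \<tau>) (probe \<theta>)) = signed_int ?V (indicator ({0..t} \<inter> {t + \<theta><..<t}))"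
    unfolding stieltjes_eq_signed_int W
    by (intro arg_cong[where f = "signed_int ?V"]) (auto simp: fun_eq_iff indicator_def)
  also have "\<dots> = signed_int ?V (\<lambda>\<tau>. indicator {m<..t} \<tau> - indicator {t} \<tau>)"
  proof (rule signed_int_cong)
    have "\<forall>\<^sub>F \<tau> in ae_both ?V. 0 < \<tau>"
      using V_loc_bv[OF \<psi>] by (rule null_below_le[of _ 0 0]) (simp add: V_right_lim[OF \<psi>] V_nonpos[OF \<psi>])
    then show "\<forall>\<^sub>F \<tau> in ae_both ?V. indicator ({0..t} \<inter> {t + \<theta><..<t}) \<tau> = (indicator {m<..t} \<tau> - indicator {t} \<tau> :: real)"
      by eventually_elim (use m in \<open>auto simp: indicator_def m_def\<close>)
  qed auto
  also have "\<dots> = signed_int ?V (indicator {m<..t}) - atom \<psi> t"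
    by (intro signed_int_diff abs_integrable_indicator[of _ _ t] V_loc_bv \<psi>) auto
  also have "signed_int ?V (indicator {m<..t}) = ?V t - ?V m"
    using signed_int_Ioc[OF V_loc_bv[OF \<psi>], of m t] m by (simp add: V_right_lim[OF \<psi>])
  finally show ?thesis
    using act_eq_probe[OF S_twin_operator[OF t'] \<psi> \<theta>'] S[OF t' probe_Yd[OF \<theta>'] \<psi>] probe[OF t' \<psi>]
    by (simp add: m_def)
qed

text \<open>
  The identity \<open>S(t + s)\<psi> = S(t) S(s)\<psi>\<close> is evaluated at \<open>-t\<close> and at \<open>-t - \<eta>\<close>. Subtracting the two equations
  cancels all terms that belong to the times \<open>t\<close> and \<open>t + s\<close>, and the value of \<open>S(s)\<psi>\<close> at \<open>-\<eta>\<close>, known from the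
  formula for \<open>S\<close>, brings in the atom at \<open>s\<close>. No limit \<open>\<eta> \<rightarrow> 0\<close> is taken: the terms in \<open>s - \<eta>\<close> cancel as well.
\<close>

lemma V_no_atoms:
  assumes s: "0 < s" and \<psi>: "\<psi> \<in> Y"
  shows "atom \<psi> s = 0"
proof -
  \<comment> \<open>chosen so that \<open>s - \<eta> \<ge> 0\<close> and \<open>-t - \<eta>\<close> lies in \<open>[-1, 0)\<close>\<close>
  define t where "t = (1/2 :: real)"
  define \<eta> where "\<eta> = min s (1/2)"
  have t: "0 < t" and \<eta>: "0 < \<eta>" "\<eta> \<le> s" "t + \<eta> \<le> 1" using s by (auto simp: t_def \<eta>_def)
  define \<phi> where "\<phi> = act (S s) \<psi>"
  have \<phi>: "\<phi> \<in> Y" unfolding \<phi>_def using s \<psi> by (intro act_Y S_twin_operator) auto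
  have prod: "act (S (t + s)) \<psi> \<theta> = act (S t) \<phi> \<theta>" if "\<theta> \<in> {-1..0}" for \<theta>
    using S_add[of t s "probe \<theta>" \<psi>] act_eq_probe[OF S_twin_operator[of "t + s"] \<psi> that]
      act_eq_probe[OF S_twin_operator[of t] \<phi> that] probe_Yd[OF that] t s \<psi> by (simp add: \<phi>_def)
  let ?V = "\<lambda>t \<psi>. V L S0 RK t \<psi>"
  have "?V s \<psi> - (?V (t + s) \<psi> - atom \<psi> (t + s)) = - (?V t \<phi> - atom \<phi> t)"
    using prod[of "-t"] act_S_eq[of "t + s" \<psi> "-t"] act_S_eq[of t \<phi> "-t"] t s \<psi> \<phi>
      Y_above[OF \<psi>, of s] Y_above[OF \<phi>, of 0] V_nonpos[OF \<phi>, of 0] \<eta> by simp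
  moreover have "?V (s - \<eta>) \<psi> - (?V (t + s) \<psi> - atom \<psi> (t + s)) = \<phi> (- \<eta>) - (?V t \<phi> - atom \<phi> t)"
    using prod[of "-(t + \<eta>)"] act_S_eq[of "t + s" \<psi> "-(t + \<eta>)"] act_S_eq[of t \<phi> "-(t + \<eta>)"] t s \<psi> \<phi>
      Y_above[OF \<psi>, of "s - \<eta>"] V_nonpos[OF \<phi>, of 0] \<eta> by simp
  moreover have "\<phi> (- \<eta>) = ?V (s - \<eta>) \<psi> - (?V s \<psi> - atom \<psi> s)"
    using act_S_eq[of s \<psi> "-\<eta>"] s \<psi> \<eta> t Y_above[OF \<psi>, of "s - \<eta>"] by (simp add: \<phi>_def)
  ultimately show ?thesis by simp
qed

lemma L_no_atom_one: "signed_int L (indicator {1}) = 0"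
proof (rule L_no_atom_if_resolvent_atomless[OF RK_resolvent])
  show "signed_int RK (indicator {s}) = 0" if "0 < s" for s
    using V_no_atoms[OF that q_Y] by (simp add: V_q)
qed

lemma V_eq_B:
  assumes \<psi>: "\<psi> \<in> Y" and t: "0 < t"
  shows "V L S0 RK t \<psi> = B L R \<psi> t"
proof -
  note f = forcing_eq_increment[OF \<psi> L_no_atom_one]
  have "stieltjes R {0..t} (\<lambda>\<tau>. V0 L S0 (t - \<tau>) \<psi>) = stieltjes R {0..t} (\<lambda>a. forcing L \<psi> (t - a))"
    unfolding stieltjes_eq_signed_int V0_eq_increment[OF \<psi>]
    by (intro arg_cong[where f = "signed_int R"]) (auto simp: fun_eq_iff indicator_def f)
  then show ?thesis
    using t by (simp add: V_def B_def RK_eq_R V0_eq_increment[OF \<psi>] f)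
qed

lemma act_S_eq_B:
  assumes \<psi>: "\<psi> \<in> Y" and t: "0 \<le> t" and \<theta>: "\<theta> \<in> {-1..0}"
  shows "act (S t) \<psi> \<theta> = B L R \<psi> (t + \<theta>) - B L R \<psi> t"
proof -
  have aY: "act (S t) \<psi> \<in> Y" by (intro act_Y S_twin_operator t \<psi>)
  consider "\<theta> = 0" | "t = 0" | "\<theta> < 0" "0 < t" using \<theta> t by fastforce
  then show ?thesis
  proof cases
    case 1
    then show ?thesis using Y_above[OF aY, of 0] by simp
  next
    case 2
    have "S 0 (probe \<theta>) \<psi> = pairing (probe \<theta>) \<psi>"
      by (rule twin_semigroup_0[OF S_twin probe_Yd[OF \<theta>] \<psi>])
    then have "act (S 0) \<psi> \<theta> = \<psi> \<theta>"
      using act_eq_probe[OF S_twin_operator[of 0] \<psi> \<theta>] pairing_probe[OF \<psi> \<theta>] by simp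
    then show ?thesis using 2 \<theta> Y_above[OF \<psi>, of 0] by (simp add: B_def)
  next
    case 3
    have "act (S t) \<psi> \<theta> = \<psi> (t + \<theta>) + V L S0 RK (max 0 (t + \<theta>)) \<psi> - B L R \<psi> t"
      using act_S_eq[of t \<psi> \<theta>] 3 \<theta> \<psi> V_no_atoms[of t \<psi>] V_eq_B[of \<psi> t] by simp
    also have "\<psi> (t + \<theta>) + V L S0 RK (max 0 (t + \<theta>)) \<psi> = B L R \<psi> (t + \<theta>)"
    proof (cases "t + \<theta> \<le> 0")
      case True
      then show ?thesis using V_nonpos[OF \<psi>, of 0] by (simp add: B_def max_def)
    next
      case False
      then show ?thesis using V_eq_B[OF \<psi>, of "t + \<theta>"] Y_above[OF \<psi>, of "t + \<theta>"] by simp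
    qed
    finally show ?thesis .
  qed
qed

end

theorem theorem12p5:
  fixes L R RK :: "real \<Rightarrow> real"
    and S0 S :: "real \<Rightarrow> bilin"
  assumes L: "L \<in> NBV 0 1" "isCont L 0"
    and R: "is_resolvent L R"
    and S0_twin: "twin_semigroup S0"
    and S0: "\<And>t \<psi> \<theta>. t \<ge> 0 \<Longrightarrow> \<psi> \<in> Y \<Longrightarrow> \<theta> \<in> {-1..0} \<Longrightarrow>
               act (S0 t) \<psi> \<theta> = (if t + \<theta> \<le> 0 then \<psi> (t + \<theta>) else 0)"
    and S0_gen: "is_generator S0 C0"
    and RK: "is_resolvent (K L S0) RK"
    and S_twin: "twin_semigroup S"
    and S: "\<And>t yd \<psi>. t \<ge> 0 \<Longrightarrow> yd \<in> Yd \<Longrightarrow> \<psi> \<in> Y \<Longrightarrow>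
               S t yd \<psi> = S0 t yd \<psi> + stieltjes (\<lambda>\<tau>. V L S0 RK \<tau> \<psi>) {0..t} (\<lambda>\<tau>. W0 S0 (t - \<tau>) yd)"
  shows "\<forall>\<psi>\<in>Y. \<forall>t\<ge>0. \<forall>\<theta>\<in>{-1..0}. act (S t) \<psi> \<theta> = B L R \<psi> (t + \<theta>) - B L R \<psi> t"
proof -
  interpret renewal_semigroup L R RK S0 S
    by unfold_locales (fact L R S0_twin S0 RK S_twin S)+
  show ?thesis using act_S_eq_B by blast
qed

end
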